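(* Let $K=K_1\times\cdots\times K_n$, where each $K_j$ is a non-polar compact subset of $\mathbb R$. For $\alpha(i)=(\alpha_1,\dots,\alpha_n)$, let $c_j=0$ if $\alpha_j=0$ and $c_j=1$ if $\alpha_j>0$. Then $$\inf\{\|P\|_K:P\in\mathcal P(\alpha(i))\}\ \ge\ \prod_{j=1}^n2^{c_j}\prod_{j=1}^n\mathrm{Cap}(K_j)^{\alpha_j},$$ and in particular $W_{\infty,\alpha(i)}(K,1)\ge2$ for all $i\ge1$. Equality holds for a given $\alpha(i)$ if and only if, for each $j$, either $\alpha_j=0$, or $K_j=R_{\alpha_j}^{-1}([-1,1])$ for some polynomial $R_{\alpha_j}$ of degree $\alpha_j$.
   Context: Monomials $z^\alpha=z_1^{\alpha_1}\cdots z_n^{\alpha_n}$, $\alpha\in\mathbb N_0^n$, are enumerated as $e_0=1,e_1,e_2,\dots$ with $e_i=z^{\alpha(i)}$. The enumeration is such that $|\alpha(i)|=\alpha_1+\dots+\alpha_n$ is non-decreasing in $i$. Among multi-indices of equal length it is ordered lexicographically: for $|\alpha|=|\beta|$, $\beta\prec\alpha$ iff for some $l$ one has $\alpha_l<\beta_l$ and $\alpha_k=\beta_k$ for all $k<l$. $\mathcal P(\alpha(i))$ denotes the set of polynomials of the form $e_i+\sum_{j<i}c_je_j$ with $c_j\in\mathbb C$. For compact $K\subset\mathbb C^n$, $\|\cdot\|_K$ denotes the sup norm on $K$. Set $t_i(K)=\inf\{\|P\|_K:P\in\mathcal P(\alpha(i))\}$ and $\tau^-(K)=\liminf_{i\to\infty}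 t_i(K)^{1/|\alpha(i)|}$. $W_{\infty,\alpha(i)}(K,1)=t_i(K)/[\tau^-(K)]^{|\alpha(i)|}$. $\mathrm{Cap}$ is logarithmic capacity. *)

theory Defs
  imports "HOL-Probability.Probability" "HOL-Computational_Algebra.Polynomial"
begin

definition prob_measures_on :: "real set \<Rightarrow> real measure set" where
  "prob_measures_on K =
     {M. sets M = sets borel \<and> prob_space M \<and> emeasure M K = 1}"

text \<open>Logarithmic kernel log(1/|x-y|), split into positive and negative parts;
  on the diagonal the positive part is +infinity.\<close>
definition log_kernel_pos :: "real \<Rightarrow> real \<Rightarrow> ennreal" where
  "log_kernel_pos x y = (if x = y then \<infinity> else ennreal (max 0 (- ln \<bar>x - y\<bar>)))"

definition log_kernel_neg :: "real \<Rightarrow> real \<Rightarrow> real" where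
  "log_kernel_neg x y = (if x = y then 0 else max 0 (ln \<bar>x - y\<bar>))"

text \<open>Logarithmic energy I(mu) = double integral of log(1/|x-y|), a value in (-inf, +inf].\<close>
definition log_energy :: "real measure \<Rightarrow> ereal" where
  "log_energy M =
     enn2ereal (\<integral>\<^sup>+ x. (\<integral>\<^sup>+ y. log_kernel_pos x y \<partial>M) \<partial>M)
     - ereal (\<integral> x. (\<integral> y. log_kernel_neg x y \<partial>M) \<partial>M)"

definition robin_const :: "real set \<Rightarrow> ereal" where
  "robin_const K = (INF M \<in> prob_measures_on K. log_energy M)"

definition log_cap :: "real set \<Rightarrow> real" where
  "log_cap K = (if robin_const K = \<infinity> then 0 else exp (- real_of_ereal (robin_const K)))"

definition non_polar :: "real set \<Rightarrow> bool" where
  "non_polar K \<longleftrightarrow> log_cap K > 0"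

definition multi_idx :: "nat \<Rightarrow> (nat \<Rightarrow> nat) set" where
  "multi_idx n = {\<alpha>. \<forall>j\<ge>n. \<alpha> j = 0}"

definition mdeg :: "nat \<Rightarrow> (nat \<Rightarrow> nat) \<Rightarrow> nat" where
  "mdeg n \<alpha> = (\<Sum>j<n. \<alpha> j)"

definition lex_prec :: "nat \<Rightarrow> (nat \<Rightarrow> nat) \<Rightarrow> (nat \<Rightarrow> nat) \<Rightarrow> bool" where
  "lex_prec n \<beta> \<alpha> \<longleftrightarrow> (\<exists>l<n. \<alpha> l < \<beta> l \<and> (\<forall>k<l. \<alpha> k = \<beta> k))"

definition before :: "nat \<Rightarrow> (nat \<Rightarrow> nat) \<Rightarrow> (nat \<Rightarrow> nat) \<Rightarrow> bool" where
  "before n \<beta> \<alpha> \<longleftrightarrow> \<beta> \<in> multi_idx n \<and>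
      (mdeg n \<beta> < mdeg n \<alpha> \<or> (mdeg n \<beta> = mdeg n \<alpha> \<and> lex_prec n \<beta> \<alpha>))"

definition enum_mi :: "nat \<Rightarrow> nat \<Rightarrow> (nat \<Rightarrow> nat)" where
  "enum_mi n i = (THE \<alpha>. \<alpha> \<in> multi_idx n \<and> card {\<beta>. before n \<beta> \<alpha>} = i)"

definition monomial :: "nat \<Rightarrow> (nat \<Rightarrow> nat) \<Rightarrow> (nat \<Rightarrow> complex) \<Rightarrow> complex" where
  "monomial n \<alpha> z = (\<Prod>j<n. z j ^ \<alpha> j)"

definition P_poly :: "nat \<Rightarrow> (nat \<Rightarrow> nat) \<Rightarrow> ((nat \<Rightarrow> nat) \<Rightarrow> complex)
                       \<Rightarrow> (nat \<Rightarrow> complex) \<Rightarrow> complex" where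
  "P_poly n \<alpha> c z = monomial n \<alpha> z + (\<Sum>\<beta>\<in>{\<beta>. before n \<beta> \<alpha>}. c \<beta> * monomial n \<beta> z)"

text \<open>K = K_1 x ... x K_n viewed in C^n (coordinates >= n are irrelevant).\<close>
definition prod_set :: "nat \<Rightarrow> (nat \<Rightarrow> real set) \<Rightarrow> (nat \<Rightarrow> complex) set" where
  "prod_set n Ks = {z. \<forall>j<n. z j \<in> complex_of_real ` Ks j}"

definition sup_norm :: "(nat \<Rightarrow> complex) set \<Rightarrow> ((nat \<Rightarrow> complex) \<Rightarrow> complex) \<Rightarrow> real" where
  "sup_norm K f = (SUP z\<in>K. cmod (f z))"

definition cheb_t :: "nat \<Rightarrow> (nat \<Rightarrow> real set) \<Rightarrow> (nat \<Rightarrow> nat) \<Rightarrow> real" where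
  "cheb_t n Ks \<alpha> = (INF c. sup_norm (prod_set n Ks) (P_poly n \<alpha> c))"

definition tau_minus :: "nat \<Rightarrow> (nat \<Rightarrow> real set) \<Rightarrow> real" where
  "tau_minus n Ks = real_of_ereal
     (liminf (\<lambda>i. ereal (cheb_t n Ks (enum_mi n i) powr (1 / real (mdeg n (enum_mi n i))))))"

definition W_inf :: "nat \<Rightarrow> (nat \<Rightarrow> real set) \<Rightarrow> nat \<Rightarrow> real" where
  "W_inf n Ks i = cheb_t n Ks (enum_mi n i) / tau_minus n Ks ^ mdeg n (enum_mi n i)"

end

theory Submission
  imports Defs "HOL-Computational_Algebra.Fundamental_Theorem_Algebra" "HOL-Real_Asymp.Real_Asymp"
    "HOL-Complex_Analysis.Complex_Analysis"
begin

text \<open>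
  The Chebyshev number of a product set is the product of the one-variable Chebyshev numbers
  \<open>t\<^sub>m(K)\<close>: an index before \<open>\<alpha>\<close> is smaller than \<open>\<alpha>\<close> in some
  coordinate, so the product of the norm-attaining functionals in the single variables (they kill
  lower degrees) sees only the leading monomial.

  In one variable, averaging a Vandermonde determinant against a measure shows that
  \<open>t\<^sub>k(K) \<le> D \<tau>\<^sup>k\<close> for all \<open>k\<close> implies \<open>Cap K \<le> \<tau>\<close>, and a
  weak limit of uniform measures on a Leja-type sequence shows that
  \<open>t\<^sub>k(K) \<ge> c s\<^sup>k\<close> for all \<open>k\<close> implies \<open>s \<le> Cap K\<close>.
  If \<open>T\<close> is monic of degree \<open>m\<close> with values in \<open>[-t,t]\<close> on \<open>K\<close>, the
  first criterion applied to Chebyshev polynomials of \<open>T\<close> gives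
  \<open>(Cap K)\<^sup>m \<le> t/2\<close>, that is \<open>t\<^sub>m(K) \<ge> 2 (Cap K)\<^sup>m\<close>.
  If equality holds for an extremal \<open>T\<close> but \<open>T\<close> takes a value of \<open>[-t,t]\<close>
  at a point outside \<open>K\<close>, then some Chebyshev polynomial of \<open>T\<close> has two roots near that
  point, and moving them lowers its norm on \<open>K\<close>, against the inequality in the higher degree.
  Conversely, for a preimage \<open>K = R\<^sup>-\<^sup>1([-1,1])\<close> the product of a polynomial over the
  fibres of \<open>R\<close> reduces the second criterion to the interval. The second criterion also
  identifies \<open>\<tau>\<^sup>-\<close> with the smallest of the capacities.
\<close>

section \<open>Lagrange interpolation and Vandermonde products\<close>

lemma degree_prod_linear_factors:
  fixes f :: "'b \<Rightarrow> 'a::idom"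
  shows "degree (\<Prod>y\<in>A. [:- f y, 1:]) = card A"
  by (cases "finite A") (simp_all add: degree_prod_eq_sum_degree)

lemma lead_coeff_prod_linear_factors:
  fixes f :: "'b \<Rightarrow> 'a::idom"
  shows "lead_coeff (\<Prod>y\<in>A. [:- f y, 1:]) = 1"
  by (simp add: lead_coeff_prod)

lemma poly_prod_linear_factors:
  fixes f :: "'b \<Rightarrow> 'a::idom"
  shows "poly (\<Prod>y\<in>A. [:- f y, 1:]) x = (\<Prod>y\<in>A. x - f y)"
  by (simp add: poly_prod)

lemma lagrange_interpolation:
  fixes p :: "'a::field poly"
  assumes "finite X" "degree p < card X"
  shows "p = (\<Sum>x\<in>X. smult (poly p x / (\<Prod>y\<in>X - {x}. x - y)) (\<Prod>y\<in>X - {x}. [:- y, 1:]))"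
    (is "p = ?q")
proof (rule poly_eqI_degree[where A = X])
  fix z assume z: "z \<in> X"
  have "poly ?q z = (\<Sum>x\<in>X. if x = z then poly p z else 0)"
    unfolding poly_sum
  proof (rule sum.cong[OF refl])
    fix x assume x: "x \<in> X"
    show "poly (smult (poly p x / (\<Prod>y\<in>X - {x}. x - y)) (\<Prod>y\<in>X - {x}. [:- y, 1:])) z =
        (if x = z then poly p z else 0)"
    proof (cases "x = z")
      case True
      have "(\<Prod>y\<in>X - {z}. z - y) \<noteq> 0" using assms by auto
      with True show ?thesis by (simp add: poly_prod)
    next
      case False
      have "(\<Prod>y\<in>X - {x}. z - y) = 0"
        using assms z False by (intro prod_zero) auto
      with False show ?thesis by (simp add: poly_prod)
    qed
  qed
  then show "poly p z = poly ?q z" using z assms by simp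
next
  have "degree ?q \<le> card X - 1"
    by (rule degree_sum_le) (use assms in \<open>auto intro!: order_trans[OF degree_smult_le]
        simp: degree_prod_linear_factors[of id, simplified]\<close>)
  moreover have "card X > 0" using assms by linarith
  ultimately show "degree ?q < card X" by linarith
qed (use assms in auto)

text \<open>Compare coefficients of degree \<open>card X - 1\<close> in Lagrange's formula: the
  numerators are monic of exactly that degree. For a monic \<open>p\<close> of that degree the sum
  is therefore 1.\<close>

lemma divided_difference_eq_coeff:
  fixes p :: "'a::field poly"
  assumes "finite X" "degree p < card X"
  shows "(\<Sum>x\<in>X. poly p x / (\<Prod>y\<in>X - {x}. x - y)) = coeff p (card X - 1)"
proof -
  have "coeff p (card X - 1) =
      (\<Sum>x\<in>X. poly p x / (\<Prod>y\<in>X - {x}. x - y) * coeff (\<Prod>y\<in>X - {x}. [:- y, 1:]) (card X - 1))"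
    by (subst lagrange_interpolation[OF assms]) (simp add: coeff_sum)
  also have "\<dots> = (\<Sum>x\<in>X. poly p x / (\<Prod>y\<in>X - {x}. x - y))"
  proof (rule sum.cong[OF refl])
    fix x assume "x \<in> X"
    then have "card X - 1 = degree (\<Prod>y\<in>X - {x}. [:- y, 1:])"
      using assms by (simp add: degree_prod_linear_factors[of id, simplified])
    then show "poly p x / (\<Prod>y\<in>X - {x}. x - y) * coeff (\<Prod>y\<in>X - {x}. [:- y, 1:]) (card X - 1)
      = poly p x / (\<Prod>y\<in>X - {x}. x - y)"
      using lead_coeff_prod_linear_factors[of id "X - {x}"] by simp
  qed
  finally show ?thesis ..
qed

text \<open>The modulus of the Vandermonde determinant of the points. Each pair enters once, larger
  minus smaller, so that all factors are positive and logarithms can be taken freely.\<close>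

definition vdm :: "real set \<Rightarrow> real" where
  "vdm X = (\<Prod>x\<in>X. \<Prod>y\<in>{y\<in>X. y < x}. x - y)"

lemma vdm_empty [simp]: "vdm {} = 1"
  by (simp add: vdm_def)

lemma vdm_insert:
  assumes "finite X" "z \<notin> X"
  shows "vdm (insert z X) = vdm X * (\<Prod>x\<in>X. \<bar>x - z\<bar>)"
proof -
  have 1: "(\<Prod>y\<in>{y\<in>insert z X. y < x}. x - y) =
      (\<Prod>y\<in>{y\<in>X. y < x}. x - y) * (if z < x then x - z else 1)" for x
  proof (cases "z < x")
    case True
    then have "{y\<in>insert z X. y < x} = insert z {y\<in>X. y < x}" by auto
    then show ?thesis using assms True by simp
  next
    case False
    then have "{y\<in>insert z X. y < x} = {y\<in>X. y < x}" by auto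
    then show ?thesis using False by simp
  qed
  have 2: "(\<Prod>y\<in>{y\<in>X. y < z}. z - y) = (\<Prod>x\<in>X. if x < z then z - x else 1)"
    using assms by (simp add: prod.inter_filter)
  have "vdm (insert z X) =
      (\<Prod>y\<in>{y\<in>X. y < z}. z - y) * (\<Prod>x\<in>X. (\<Prod>y\<in>{y\<in>X. y < x}. x - y) * (if z < x then x - z else 1))"
    by (simp only: vdm_def prod.insert[OF assms] 1) simp
  also have "\<dots> = vdm X * (\<Prod>x\<in>X. (if x < z then z - x else 1) * (if z < x then x - z else 1))"
    by (simp add: 2 prod.distrib vdm_def)
  also have "(\<Prod>x\<in>X. (if x < z then z - x else 1) * (if z < x then x - z else 1)) = (\<Prod>x\<in>X. \<bar>x - z\<bar>)"
    using assms by (intro prod.cong) auto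
  finally show ?thesis .
qed

lemma vdm_pos: "vdm X > 0"
  by (auto simp: vdm_def intro!: prod_pos)

lemma vdm_remove:
  assumes "finite X" "x \<in> X"
  shows "vdm X = vdm (X - {x}) * (\<Prod>y\<in>X - {x}. \<bar>x - y\<bar>)"
  using vdm_insert[of "X - {x}" x] assms by (simp add: insert_absorb abs_minus_commute)

text \<open>By Lagrange interpolation the leading coefficient 1 of a monic polynomial is bounded by its
  sup norm times the sum of the quotients \<^term>\<open>vdm (X - {x}) / vdm X\<close>.\<close>

lemma vdm_le_fact_prod:
  fixes p :: "nat \<Rightarrow> real poly"
  assumes "\<And>k. degree (p k) = k" "\<And>k. lead_coeff (p k) = 1"
    and "\<And>k x. x \<in> K \<Longrightarrow> \<bar>poly (p k) x\<bar> \<le> b k"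
    and "finite X" "X \<subseteq> K" "card X = N"
  shows "vdm X \<le> fact N * (\<Prod>k<N. b k)"
  using assms(4-6)
proof (induction N arbitrary: X)
  case 0
  then show ?case by simp
next
  case (Suc N)
  obtain x0 where "x0 \<in> X" using Suc.prems by fastforce
  then have b: "0 \<le> b k" for k
    using assms(3)[of x0 k] Suc.prems abs_ge_zero order_trans by (meson subsetD)
  have "1 = coeff (p N) (card X - 1)"
    using assms(1,2)[of N] Suc.prems by simp
  also have "\<dots> = (\<Sum>x\<in>X. poly (p N) x / (\<Prod>y\<in>X - {x}. x - y))"
    using Suc.prems assms(1)[of N] by (subst divided_difference_eq_coeff) auto
  finally have "vdm X = vdm X * (\<Sum>x\<in>X. poly (p N) x / (\<Prod>y\<in>X - {x}. x - y))" by simp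
  also have "\<dots> = (\<Sum>x\<in>X. vdm X * (poly (p N) x / (\<Prod>y\<in>X - {x}. x - y)))"
    by (simp add: sum_distrib_left)
  also have "\<dots> \<le> (\<Sum>x\<in>X. b N * (fact N * (\<Prod>k<N. b k)))"
  proof (rule sum_mono)
    fix x assume x: "x \<in> X"
    have nz: "(\<Prod>y\<in>X - {x}. x - y) \<noteq> 0" using Suc.prems by auto
    have "vdm X * (poly (p N) x / (\<Prod>y\<in>X - {x}. x - y)) \<le>
        \<bar>vdm X * (poly (p N) x / (\<Prod>y\<in>X - {x}. x - y))\<bar>" by (rule abs_ge_self)
    \<comment> \<open>Up to sign the denominator is the product of all factors of
      \<open>vdm X\<close> that involve \<open>x\<close>; cancelling it leaves one point fewer,
      ready for the induction hypothesis.\<close>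
    also have "\<dots> = vdm (X - {x}) * \<bar>poly (p N) x\<bar>"
    proof -
      have "(\<Prod>y\<in>X - {x}. \<bar>x - y\<bar>) \<noteq> 0" using nz by (simp flip: abs_prod)
      then show ?thesis using vdm_pos[of "X - {x}"]
        by (simp add: vdm_remove[OF Suc.prems(1) x] abs_mult abs_prod)
    qed
    also have "\<dots> \<le> (fact N * (\<Prod>k<N. b k)) * b N"
      using Suc.IH[of "X - {x}"] Suc.prems x assms(3)[of x N] vdm_pos[of "X - {x}"] b
      by (intro mult_mono) (auto intro!: mult_nonneg_nonneg prod_nonneg)
    finally show "vdm X * (poly (p N) x / (\<Prod>y\<in>X - {x}. x - y)) \<le> b N * (fact N * (\<Prod>k<N. b k))"
      by (simp add: mult.commute)
  qed
  also have "\<dots> = fact (Suc N) * (\<Prod>k<Suc N. b k)"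
    using Suc.prems by (simp add: algebra_simps)
  finally show ?case .
qed

section \<open>Lower bounds for the logarithmic energy\<close>

lemma log_kernel_pos_measurable [measurable]:
  "case_prod log_kernel_pos \<in> borel_measurable (borel \<Otimes>\<^sub>M borel)"
  unfolding log_kernel_pos_def case_prod_beta by measurable

lemma log_kernel_neg_measurable [measurable]:
  "case_prod log_kernel_neg \<in> borel_measurable (borel \<Otimes>\<^sub>M borel)"
  unfolding log_kernel_neg_def case_prod_beta by measurable

lemma log_kernel_neg_nonneg: "0 \<le> log_kernel_neg x y"
  by (simp add: log_kernel_neg_def)

text \<open>Where \<open>C\<close> bounds the negative part, this is log(1/|x-y|) + C, a nonnegative
  kernel. Energies can then be handled entirely by nonnegative integrals, without differences of
  extended reals.\<close>

definition shifted_kernel :: "real \<Rightarrow> real \<Rightarrow> real \<Rightarrow> ennreal" where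
  "shifted_kernel C x y = log_kernel_pos x y + ennreal (C - log_kernel_neg x y)"

lemma shifted_kernel_measurable [measurable]:
  "case_prod (shifted_kernel C) \<in> borel_measurable (borel \<Otimes>\<^sub>M borel)"
  unfolding shifted_kernel_def case_prod_beta by measurable

lemma shifted_kernel_diag [simp]: "shifted_kernel C x x = \<infinity>"
  by (simp add: shifted_kernel_def log_kernel_pos_def)

lemma shifted_kernel_offdiag:
  assumes "x \<noteq> y" "log_kernel_neg x y \<le> C"
  shows "shifted_kernel C x y = ennreal (C - ln \<bar>x - y\<bar>)" "ln \<bar>x - y\<bar> \<le> C"
proof -
  have "ln \<bar>x - y\<bar> \<le> log_kernel_neg x y" using assms(1) by (simp add: log_kernel_neg_def)
  then show "ln \<bar>x - y\<bar> \<le> C" using assms(2) by linarith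
  show "shifted_kernel C x y = ennreal (C - ln \<bar>x - y\<bar>)"
    using assms
    by (auto simp: shifted_kernel_def log_kernel_pos_def log_kernel_neg_def max_def ennreal_plus[symmetric]
        simp del: ennreal_plus)
qed

lemma log_kernel_neg_bounded:
  assumes "bounded K"
  obtains C where "C \<ge> 0" "\<And>x y. x \<in> K \<Longrightarrow> y \<in> K \<Longrightarrow> log_kernel_neg x y \<le> C"
proof -
  obtain B where B: "\<And>x. x \<in> K \<Longrightarrow> \<bar>x\<bar> \<le> B"
    using assms by (auto simp: bounded_iff)
  show ?thesis
  proof (rule that[of "max 0 (ln (max 1 (2 * B)))"])
    fix x y assume "x \<in> K" "y \<in> K"
    then have *: "\<bar>x - y\<bar> \<le> max 1 (2 * B)" using B[of x] B[of y] by linarith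
    show "log_kernel_neg x y \<le> max 0 (ln (max 1 (2 * B)))"
    proof (cases "x = y")
      case False
      then have "ln \<bar>x - y\<bar> \<le> ln (max 1 (2 * B))" using * by (subst ln_le_cancel_iff) auto
      then show ?thesis by (auto simp: log_kernel_neg_def)
    qed (simp add: log_kernel_neg_def)
  qed simp
qed

lemma prob_measures_onD:
  assumes "M \<in> prob_measures_on K" "compact K"
  shows "sets M = sets borel" "prob_space M" "AE x in M. x \<in> K"
proof -
  show 1: "sets M = sets borel" "prob_space M" using assms by (auto simp: prob_measures_on_def)
  interpret prob_space M by fact
  have "K \<in> sets M" using assms 1 by (simp add: borel_compact)
  moreover have "prob K = 1"
    using assms by (simp add: prob_measures_on_def measure_def)
  ultimately show "AE x in M. x \<in> K" by (simp add: AE_in_set_eq_1)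
qed

text \<open>On the support the negative part lies between 0 and \<open>C\<close>, so it is
  integrable in each variable and the shift splits off linearly; total mass 1 turns the constant
  \<open>C\<close> into itself.\<close>

lemma nn_integral_shifted_kernel:
  assumes M: "M \<in> prob_measures_on K" and K: "compact K"
    and C: "\<And>x y. x \<in> K \<Longrightarrow> y \<in> K \<Longrightarrow> log_kernel_neg x y \<le> C"
  defines "m \<equiv> (\<integral>x. (\<integral>y. log_kernel_neg x y \<partial>M) \<partial>M)"
  shows "(\<integral>\<^sup>+x. \<integral>\<^sup>+y. shifted_kernel C x y \<partial>M \<partial>M) =
      (\<integral>\<^sup>+x. \<integral>\<^sup>+y. log_kernel_pos x y \<partial>M \<partial>M) + ennreal (C - m)" "0 \<le> m" "m \<le> C"
proof -
  note [measurable_cong] = prob_measures_onD(1)[OF M K]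
  interpret prob_space M by (rule prob_measures_onD[OF M K])
  note AE = prob_measures_onD(3)[OF M K]
  define u where "u x = (\<integral>y. log_kernel_neg x y \<partial>M)" for x
  have [measurable]: "u \<in> borel_measurable M" unfolding u_def by measurable
  have int: "integrable M (log_kernel_neg x)" if "x \<in> K" for x
    by (rule integrable_const_bound[where B = C])
      (use AE C that in \<open>auto simp: log_kernel_neg_nonneg\<close>)
  have u: "0 \<le> u x" "u x \<le> C" if "x \<in> K" for x
  proof -
    show "0 \<le> u x" unfolding u_def by (intro Bochner_Integration.integral_nonneg) (auto simp: log_kernel_neg_nonneg)
    show "u x \<le> C" unfolding u_def
      by (rule integral_le_const[OF int[OF that]]) (use AE C that in auto)
  qed
  have iu: "integrable M u"
    by (rule integrable_const_bound[where B = C]) (use AE u in auto)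
  show "0 \<le> m" unfolding m_def u_def[symmetric]
    by (rule integral_nonneg_AE) (use AE u in auto)
  show "m \<le> C" unfolding m_def u_def[symmetric]
    by (rule integral_le_const[OF iu]) (use AE u in auto)
  have inner: "(\<integral>\<^sup>+y. shifted_kernel C x y \<partial>M) = (\<integral>\<^sup>+y. log_kernel_pos x y \<partial>M) + ennreal (C - u x)"
    if x: "x \<in> K" for x
  proof -
    have "(\<integral>\<^sup>+y. ennreal (C - log_kernel_neg x y) \<partial>M) = ennreal (\<integral>y. C - log_kernel_neg x y \<partial>M)"
      by (rule nn_integral_eq_integral) (use AE C x int[OF x] in auto)
    also have "(\<integral>y. C - log_kernel_neg x y \<partial>M) = C - u x"
      using int[OF x] by (simp add: u_def prob_space)
    finally show ?thesis unfolding shifted_kernel_def by (subst nn_integral_add) auto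
  qed
  have "(\<integral>\<^sup>+x. \<integral>\<^sup>+y. shifted_kernel C x y \<partial>M \<partial>M) =
      (\<integral>\<^sup>+x. (\<integral>\<^sup>+y. log_kernel_pos x y \<partial>M) + ennreal (C - u x) \<partial>M)"
    by (rule nn_integral_cong_AE) (use AE inner in auto)
  also have "\<dots> = (\<integral>\<^sup>+x. \<integral>\<^sup>+y. log_kernel_pos x y \<partial>M \<partial>M) + (\<integral>\<^sup>+x. ennreal (C - u x) \<partial>M)"
    by (rule nn_integral_add) auto
  also have "(\<integral>\<^sup>+x. ennreal (C - u x) \<partial>M) = ennreal (\<integral>x. C - u x \<partial>M)"
    by (rule nn_integral_eq_integral) (use AE u iu in auto)
  also have "(\<integral>x. C - u x \<partial>M) = C - m"
    unfolding m_def u_def[symmetric] using iu by (simp add: prob_space)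
  finally show "(\<integral>\<^sup>+x. \<integral>\<^sup>+y. shifted_kernel C x y \<partial>M \<partial>M) =
      (\<integral>\<^sup>+x. \<integral>\<^sup>+y. log_kernel_pos x y \<partial>M \<partial>M) + ennreal (C - m)" .
qed

text \<open>The only form in which energies are compared below. The condition
  \<open>0 \<le> C + r\<close> keeps \<open>ennreal\<close> from truncating the right-hand
  side.\<close>

lemma log_energy_le_iff:
  assumes M: "M \<in> prob_measures_on K" and K: "compact K"
    and C: "\<And>x y. x \<in> K \<Longrightarrow> y \<in> K \<Longrightarrow> log_kernel_neg x y \<le> C"
    and "0 \<le> C + r"
  shows "log_energy M \<le> ereal r \<longleftrightarrow>
    (\<integral>\<^sup>+x. \<integral>\<^sup>+y. shifted_kernel C x y \<partial>M \<partial>M) \<le> ennreal (C + r)"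
proof -
  define P where "P = (\<integral>\<^sup>+x. \<integral>\<^sup>+y. log_kernel_pos x y \<partial>M \<partial>M)"
  define m where "m = (\<integral>x. (\<integral>y. log_kernel_neg x y \<partial>M) \<partial>M)"
  have *: "log_energy M = enn2ereal P - ereal m" by (simp add: log_energy_def P_def m_def)
  note I = nn_integral_shifted_kernel[OF M K C, folded m_def P_def]
  show ?thesis
  proof (cases P)
    case (real p)
    then show ?thesis
      using I assms(4) by (auto simp: * ennreal_plus[symmetric] simp del: ennreal_plus)
  next
    case top
    then show ?thesis using I by (simp add: * top_unique)
  qed
qed

text \<open>Lists rather than sets, because points integrated independently against a measure may
  coincide. Each pair of positions is counted once.\<close>

fun pair_sum :: "('a \<Rightarrow> 'a \<Rightarrow> ennreal) \<Rightarrow> 'a list \<Rightarrow> ennreal" where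
  "pair_sum k [] = 0"
| "pair_sum k (y # xs) = pair_sum k xs + (\<Sum>x\<leftarrow>xs. k x y)"

text \<open>Integrating a lower bound for the pair sum over all variables, one variable at a time:
  \<^term>\<open>xs\<close> lists the variables that are still fixed and \<^term>\<open>s\<close> counts the integrated ones.\<close>

lemma pair_sum_average:
  assumes "prob_space M" "AE x in M. x \<in> K"
    and k [measurable]: "case_prod k \<in> borel_measurable (M \<Otimes>\<^sub>M M)"
    and sp: "K \<subseteq> space M"
    and bound: "\<And>xs. set xs \<subseteq> K \<Longrightarrow> length xs = N \<Longrightarrow> c \<le> pair_sum k xs"
  shows "set xs \<subseteq> K \<Longrightarrow> length xs + s = N \<Longrightarrow>
    c \<le> pair_sum k xs + of_nat s * (\<Sum>x\<leftarrow>xs. \<integral>\<^sup>+y. k x y \<partial>M)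
        + of_nat (s * (s - 1) div 2) * (\<integral>\<^sup>+x. \<integral>\<^sup>+y. k x y \<partial>M \<partial>M)"
proof (induction s arbitrary: xs)
  case 0
  then show ?case using bound[of xs] by simp
next
  case (Suc s)
  interpret prob_space M by fact
  define U where "U x = (\<integral>\<^sup>+y. k x y \<partial>M)" for x
  define I where "I = (\<integral>\<^sup>+x. U x \<partial>M)"
  have [measurable]: "U \<in> borel_measurable M" unfolding U_def by measurable
  have km [measurable]: "k x \<in> borel_measurable M" if "x \<in> set xs" for x
  proof -
    have "x \<in> space M" using that Suc.prems sp by auto
    then have "(\<lambda>y. (x, y)) \<in> M \<rightarrow>\<^sub>M M \<Otimes>\<^sub>M M" by measurable
    from measurable_compose[OF this k] show ?thesis by simp
  qed
  have sum_int: "(\<integral>\<^sup>+y. (\<Sum>x\<leftarrow>ys. k x y) \<partial>M) = (\<Sum>x\<leftarrow>ys. U x)" if "set ys \<subseteq> set xs" for ys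
    using that
  proof (induction ys)
    case (Cons a ys)
    have [measurable]: "(\<lambda>y. \<Sum>x\<leftarrow>ys. k x y) \<in> borel_measurable M"
      using Cons.prems by (induction ys) auto
    show ?case using Cons by (simp add: nn_integral_add U_def)
  qed simp
  have [measurable]: "(\<lambda>y. \<Sum>x\<leftarrow>xs. k x y) \<in> borel_measurable M"
  proof -
    have "(\<lambda>y. \<Sum>x\<leftarrow>ys. k x y) \<in> borel_measurable M" if "set ys \<subseteq> set xs" for ys
      using that by (induction ys) auto
    then show ?thesis by simp
  qed
  \<comment> \<open>The induction hypothesis holds for almost every additional fixed point
    \<open>y\<close>; integrating it over \<open>y\<close> moves \<open>y\<close> from the fixed to
    the integrated variables.\<close>
  have "c = (\<integral>\<^sup>+y. c \<partial>M)" by (simp add: emeasure_space_1)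
  also have "\<dots> \<le> (\<integral>\<^sup>+y. (pair_sum k xs + (\<Sum>x\<leftarrow>xs. k x y)) + of_nat s * (U y + (\<Sum>x\<leftarrow>xs. U x))
      + of_nat (s * (s - 1) div 2) * I \<partial>M)"
  proof (rule nn_integral_mono_AE, use assms(2) in eventually_elim)
    case (elim y)
    then show ?case using Suc.IH[of "y # xs"] Suc.prems by (simp add: U_def I_def)
  qed
  also have "\<dots> = (pair_sum k xs + (\<Sum>x\<leftarrow>xs. U x)) + of_nat s * (I + (\<Sum>x\<leftarrow>xs. U x))
      + of_nat (s * (s - 1) div 2) * I"
    by (simp add: nn_integral_add nn_integral_cmult emeasure_space_1 sum_int I_def)
  also have "\<dots> = pair_sum k xs + of_nat (Suc s) * (\<Sum>x\<leftarrow>xs. U x)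
        + of_nat (s + s * (s - 1) div 2) * I"
    by (simp add: algebra_simps)
  \<comment> \<open>The new integrated variable forms \<open>s\<close> further pairs with those
    integrated before.\<close>
  also have "s + s * (s - 1) div 2 = Suc s * (Suc s - 1) div 2"
    by (cases s) (auto simp: algebra_simps)
  finally show ?case by (simp add: U_def I_def)
qed

text \<open>Each pair contributes \<open>C\<close> minus one logarithm, and the logarithms add up to
  \<open>ln (vdm (set xs))\<close>. The second conjunct is carried through the induction so that
  \<open>ennreal\<close> is additive on these values.\<close>

lemma pair_sum_distinct:
  assumes "set xs \<subseteq> K" "distinct xs"
    and C: "\<And>x y. x \<in> K \<Longrightarrow> y \<in> K \<Longrightarrow> log_kernel_neg x y \<le> C"
  shows "pair_sum (shifted_kernel C) xs =
      ennreal (real (length xs * (length xs - 1) div 2) * C - ln (vdm (set xs)))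
    \<and> 0 \<le> real (length xs * (length xs - 1) div 2) * C - ln (vdm (set xs))"
  using assms(1,2)
proof (induction xs)
  case (Cons z xs)
  have 1: "(\<Sum>x\<leftarrow>ys. shifted_kernel C x z) = ennreal (real (length ys) * C - (\<Sum>x\<leftarrow>ys. ln \<bar>x - z\<bar>))
     \<and> 0 \<le> real (length ys) * C - (\<Sum>x\<leftarrow>ys. ln \<bar>x - z\<bar>)"
    if "set ys \<subseteq> K" "z \<notin> set ys" for ys
    using that
  proof (induction ys)
    case (Cons a ys)
    have "a \<noteq> z" "log_kernel_neg a z \<le> C" using Cons.prems C \<open>set (z # xs) \<subseteq> K\<close> by auto
    from shifted_kernel_offdiag[OF this] Cons show ?case
      by (simp add: algebra_simps ennreal_plus[symmetric] del: ennreal_plus)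
  qed simp
  have "ln (vdm (set (z # xs))) = ln (vdm (set xs)) + (\<Sum>x\<in>set xs. ln \<bar>x - z\<bar>)"
  proof -
    have "(\<Prod>x\<in>set xs. \<bar>x - z\<bar>) > 0" using Cons.prems by (intro prod_pos) auto
    moreover have "ln (\<Prod>x\<in>set xs. \<bar>x - z\<bar>) = (\<Sum>x\<in>set xs. ln \<bar>x - z\<bar>)"
      using Cons.prems by (intro ln_prod) auto
    ultimately show ?thesis
      using Cons.prems vdm_pos[of "set xs"] by (simp add: vdm_insert ln_mult_pos)
  qed
  also have "(\<Sum>x\<in>set xs. ln \<bar>x - z\<bar>) = (\<Sum>x\<leftarrow>xs. ln \<bar>x - z\<bar>)"
    using Cons.prems by (simp add: sum_list_distinct_conv_sum_set)
  finally have 2: "ln (vdm (set (z # xs))) = ln (vdm (set xs)) + (\<Sum>x\<leftarrow>xs. ln \<bar>x - z\<bar>)" .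
  have 3: "length (z # xs) * (length (z # xs) - 1) div 2 = length xs * (length xs - 1) div 2 + length xs"
    by (cases xs) (auto simp: algebra_simps)
  show ?case using Cons 1[of xs] unfolding 2 3
    by (simp add: algebra_simps ennreal_plus[symmetric] del: ennreal_plus)
qed simp

text \<open>A repeated point brings in the infinite diagonal value, so any lower bound for the pair
  sum is trivial there and the Vandermonde estimate is needed for distinct points only.\<close>

lemma pair_sum_not_distinct:
  "\<not> distinct xs \<Longrightarrow> pair_sum (shifted_kernel C) xs = \<infinity>"
proof (induction xs)
  case (Cons z xs)
  show ?case
  proof (cases "z \<in> set xs")
    case True
    then have "(\<Sum>x\<leftarrow>xs. shifted_kernel C x z) = \<infinity>" by (induction xs) auto
    then show ?thesis by simp
  qed (use Cons in auto)
qed simp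

text \<open>Average the pair sum over \<open>N\<close> independent points. The result is N(N-1)/2
  times the (shifted) energy, while pointwise log(1/vdm) is at least -ln(N! D^N) - N(N-1)/2 ln
  \<tau>. After division by N(N-1)/2 the terms from N! and D^N vanish in the limit.\<close>

lemma log_energy_lower_bound:
  fixes p :: "nat \<Rightarrow> real poly"
  assumes K: "compact K" and M: "M \<in> prob_measures_on K" and "\<tau> > 0" "D \<ge> 1"
    and p: "\<And>k. degree (p k) = k" "\<And>k. lead_coeff (p k) = 1"
      "\<And>k x. x \<in> K \<Longrightarrow> \<bar>poly (p k) x\<bar> \<le> D * \<tau> ^ k"
  shows "ereal (- ln \<tau>) \<le> log_energy M"
proof (rule ccontr)
  assume "\<not> ?thesis"
  then have lt: "log_energy M < ereal (- ln \<tau>)" by simp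
  obtain C0 where C0: "\<And>x y. x \<in> K \<Longrightarrow> y \<in> K \<Longrightarrow> log_kernel_neg x y \<le> C0"
    using log_kernel_neg_bounded[OF compact_imp_bounded[OF K]] by metis
  \<comment> \<open>The second entry gives \<open>- C < - ln \<tau>\<close>, which leaves room for
    an \<open>r\<close> below \<open>- ln \<tau>\<close> with \<open>C + r\<close>
    nonnegative.\<close>
  define C where "C = max C0 (ln \<tau> + 1)"
  have C: "log_kernel_neg x y \<le> C" if "x \<in> K" "y \<in> K" for x y
    using C0[OF that] by (simp add: C_def)
  have "max (log_energy M) (ereal (- C)) < ereal (- ln \<tau>)" using lt by (simp add: C_def)
  then obtain r where r: "max (log_energy M) (ereal (- C)) < ereal r" "ereal r < ereal (- ln \<tau>)"
    using ereal_dense2 by blast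
  then have r': "0 \<le> C + r" "log_energy M \<le> ereal r" "r < - ln \<tau>" by auto
  define I where "I = (\<integral>\<^sup>+x. \<integral>\<^sup>+y. shifted_kernel C x y \<partial>M \<partial>M)"
  have I: "I \<le> ennreal (C + r)"
    unfolding I_def using log_energy_le_iff[OF M K C r'(1)] r' by simp
  note [measurable_cong] = prob_measures_onD(1)[OF M K]
  have main: "(real N - 1) / 2 * (- ln \<tau> - r) \<le> ln N + ln D" if N: "N \<ge> 1" for N :: nat
  proof -
    define L where "L = N * (N - 1) div 2"
    have L: "real L = real N * (real N - 1) / 2"
      using N by (simp add: L_def real_of_nat_div of_nat_diff)
    define b where "b = fact N * (\<Prod>k<N. D * \<tau> ^ k)"
    have "b > 0" using assms by (auto simp: b_def intro!: mult_pos_pos prod_pos)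
    have "ennreal (L * C - ln b) \<le> pair_sum (shifted_kernel C) xs"
      if "set xs \<subseteq> K" "length xs = N" for xs
    proof (cases "distinct xs")
      case True
      have "vdm (set xs) \<le> b"
        unfolding b_def using that True distinct_card[of xs]
        by (intro vdm_le_fact_prod[where K = K and p = p]) (use p in auto)
      then have "ln (vdm (set xs)) \<le> ln b" using vdm_pos[of "set xs"] \<open>b > 0\<close> by simp
      with pair_sum_distinct[OF that(1) True, of C] C that show ?thesis
        by (auto simp: L_def intro!: ennreal_leI)
    qed (simp add: pair_sum_not_distinct)
    then have "ennreal (L * C - ln b) \<le> pair_sum (shifted_kernel C) []
        + of_nat N * (\<Sum>x\<leftarrow>[]. \<integral>\<^sup>+y. shifted_kernel C x y \<partial>M) + of_nat (N * (N - 1) div 2) * I"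
      unfolding I_def
      by (intro pair_sum_average[where K = K and N = N])
        (use prob_measures_onD[OF M K] sets_eq_imp_space_eq[OF prob_measures_onD(1)[OF M K]] in auto)
    also have "\<dots> = of_nat L * I" by (simp add: L_def)
    also have "\<dots> \<le> of_nat L * ennreal (C + r)" by (intro mult_left_mono I) simp
    also have "\<dots> = ennreal (L * (C + r))"
      using r'(1) by (simp add: ennreal_mult ennreal_of_nat_eq_real_of_nat)
    finally have "L * C - ln b \<le> L * (C + r)"
      using r'(1) by (subst (asm) ennreal_le_iff) auto
    then have 1: "- ln b \<le> L * r" by (simp add: algebra_simps)
    have "ln b = ln (fact N) + (\<Sum>k<N. ln (D * \<tau> ^ k))"
      using assms unfolding b_def by (subst ln_mult_pos) (auto intro!: prod_pos ln_prod)
    also have "(\<Sum>k<N. ln (D * \<tau> ^ k)) = (\<Sum>k<N. ln D + real k * ln \<tau>)"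
      using assms by (intro sum.cong) (auto simp: ln_mult_pos ln_realpow)
    also have "\<dots> = N * ln D + (\<Sum>k<N. real k) * ln \<tau>"
      by (simp add: sum.distrib sum_distrib_right)
    also have "(\<Sum>k<N. real k) = L"
      unfolding L by (induction N) (auto simp: field_simps)
    also have "ln (fact N :: real) \<le> N * ln N"
    proof -
      have "(fact N :: real) \<le> real N ^ N" using fact_le_power[of N, where ?'a = real] by simp
      then have "ln (fact N :: real) \<le> ln (real N ^ N)" using N by (subst ln_le_cancel_iff) auto
      then show ?thesis using N by (simp add: ln_realpow)
    qed
    finally have "ln b \<le> N * ln N + (N * ln D + L * ln \<tau>)" by simp
    with 1 have "L * (- ln \<tau> - r) \<le> N * (ln N + ln D)" by (simp add: algebra_simps)
    then have "N * ((real N - 1) / 2 * (- ln \<tau> - r)) \<le> N * (ln N + ln D)"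
      by (simp add: L)
    then show ?thesis using N by (subst (asm) mult_le_cancel_left_pos) auto
  qed
  define \<delta> where "\<delta> = - ln \<tau> - r"
  have "\<delta> > 0" using r' by (simp add: \<delta>_def)
  \<comment> \<open>A linear function of \<open>N\<close> with positive slope outgrows the
    logarithm, contradicting \<open>main\<close> for large \<open>N\<close>.\<close>
  then have "eventually (\<lambda>N. (real N - 1) / 2 * \<delta> > ln (real N) + ln D) at_top"
    by real_asymp
  then have "eventually (\<lambda>N. False) (at_top :: nat filter)"
    using eventually_ge_at_top[of 1]
    by eventually_elim (use main in \<open>fastforce simp: \<delta>_def\<close>)
  then show False by simp
qed

section \<open>Measures of small energy from Leja-type sequences\<close>

lemma sum_square_symmetric:
  fixes h :: "nat \<Rightarrow> nat \<Rightarrow> 'a::comm_semiring_1"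
  assumes "\<And>i j. h i j = h j i"
  shows "(\<Sum>i<N. \<Sum>j<N. h i j) = (\<Sum>j<N. h j j + 2 * (\<Sum>i<j. h i j))"
proof (induction N)
  case (Suc N)
  have "(\<Sum>i<Suc N. \<Sum>j<Suc N. h i j) =
      (\<Sum>i<N. \<Sum>j<N. h i j) + (\<Sum>i<N. h i N) + ((\<Sum>j<N. h N j) + h N N)"
    by (simp add: sum.distrib add_ac)
  also have "(\<Sum>j<N. h N j) = (\<Sum>j<N. h j N)" using assms by (intro sum.cong) auto
  finally show ?case using Suc by (simp add: mult_2 algebra_simps)
qed simp

text \<open>The shifted kernel cut off at height \<open>C + L\<close>. It is continuous and finite
  on the diagonal, so it passes to weak limits and admits point masses.\<close>

definition cutoff_kernel :: "real \<Rightarrow> real \<Rightarrow> real \<Rightarrow> real \<Rightarrow> real" where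
  "cutoff_kernel C L x y = C - ln (max \<bar>x - y\<bar> (exp (- L)))"

lemma cutoff_kernel_measurable [measurable]:
  "case_prod (cutoff_kernel C L) \<in> borel_measurable (borel \<Otimes>\<^sub>M borel)"
  unfolding cutoff_kernel_def case_prod_beta by measurable

lemma tendsto_cutoff_kernel:
  assumes "(f \<longlongrightarrow> x) F" "(g \<longlongrightarrow> y) F"
  shows "((\<lambda>n. cutoff_kernel C L (f n) (g n)) \<longlongrightarrow> cutoff_kernel C L x y) F"
  unfolding cutoff_kernel_def
  by (intro tendsto_intros assms) (metis exp_gt_zero less_max_iff_disj less_irrefl)

text \<open>Removing the cutoff recovers the kernel: off the diagonal the cutoff is eventually
  inactive, and on it the value \<open>C + n\<close> tends to infinity. The form with
  \<open>liminf\<close> is the one that Fatou's lemma takes.\<close>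

lemma shifted_kernel_le_liminf_cutoff:
  assumes "log_kernel_neg x y \<le> C"
  shows "shifted_kernel C x y \<le> liminf (\<lambda>n. ennreal (cutoff_kernel C (real n) x y))"
proof (cases "x = y")
  case True
  have "filterlim (\<lambda>n. C + real n) at_top sequentially" by real_asymp
  then have "(\<lambda>n. ennreal (C + real n)) \<longlonglongrightarrow> \<infinity>"
    by (simp add: ennreal_tendsto_top_eq_at_top)
  then have "liminf (\<lambda>n. ennreal (C + real n)) = \<infinity>" by (intro lim_imp_Liminf) auto
  then show ?thesis using True by (simp add: cutoff_kernel_def)
next
  case False
  have "eventually (\<lambda>n. exp (- real n) < \<bar>x - y\<bar>) sequentially"
    using False by real_asymp
  then have "eventually (\<lambda>n. ennreal (C - ln \<bar>x - y\<bar>) \<le> ennreal (cutoff_kernel C (real n) x y)) sequentially"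
    by eventually_elim (simp add: cutoff_kernel_def max_def)
  then show ?thesis
    unfolding shifted_kernel_offdiag[OF False assms] by (rule Liminf_bounded)
qed

section \<open>Weak limits of empirical measures of a Leja-type sequence\<close>

context
  fixes K :: "real set" and x :: "nat \<Rightarrow> real" and c s :: real
  assumes K: "compact K" and x: "\<And>N. x N \<in> K"
    and cs: "c > 0" "s > 0"
    and leja: "\<And>N. c * s ^ N \<le> (\<Prod>i<N. \<bar>x N - x i\<bar>)"
begin

text \<open>Equal weights on the \<open>N + 1\<close> points \<open>x 0\<close> to
  \<open>x N\<close>; the index set is never empty.\<close>

definition empirical :: "nat \<Rightarrow> real measure" where
  "empirical N = distr (measure_pmf (pmf_of_set {..N})) borel x"

lemma real_distribution_empirical: "real_distribution (empirical N)"
  unfolding empirical_def 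
  by (intro prob_space.real_distribution_distr measure_pmf.prob_space_axioms) simp

lemma empirical_AE: "AE y in empirical N. y \<in> K"
  unfolding empirical_def using x borel_compact[OF K]
  by (subst AE_distr_iff) auto

lemma nn_integral_empirical:
  assumes "f \<in> borel_measurable borel"
  shows "(\<integral>\<^sup>+y. f y \<partial>empirical N) = (\<Sum>i<Suc N. f (x i)) / of_nat (Suc N)"
  unfolding empirical_def using assms
  by (subst nn_integral_distr) (auto simp: nn_integral_pmf_of_set lessThan_Suc_atMost)

text \<open>The \<open>N + 1\<close> diagonal terms are \<open>C + L\<close> each and disappear
  after division by the square of \<open>N + 1\<close>. The other terms are twice the sums over
  \<open>i < j\<close>, which the hypothesis \<open>leja\<close> controls through the logarithm of
  its product. As \<open>N\<close> grows the bound tends to \<open>C - ln s\<close>.\<close>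

lemma cutoff_energy_empirical:
  assumes C: "\<And>x y. x \<in> K \<Longrightarrow> y \<in> K \<Longrightarrow> log_kernel_neg x y \<le> C" "C \<ge> 0" "L \<ge> 0"
  shows "(\<integral>\<^sup>+y. \<integral>\<^sup>+z. ennreal (cutoff_kernel C L y z) \<partial>empirical N \<partial>empirical N) \<le>
     ennreal ((C + L - 2 * ln c) / real (Suc N) + real N / real (Suc N) * (C - ln s))"
proof -
  define h where "h i j = cutoff_kernel C L (x i) (x j)" for i j
  \<comment> \<open>A repetition would make the product in \<open>leja\<close> zero, but its lower
    bound is positive.\<close>
  have inj: "x i \<noteq> x j" if "i < j" for i j
  proof
    assume "x i = x j"
    then have "(\<Prod>i<j. \<bar>x j - x i\<bar>) = 0" using that by (intro prod_zero) (auto intro!: bexI[of _ i])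
    moreover have "c * s ^ j > 0" using cs by simp
    ultimately show False using leja[of j] by linarith
  qed
  have hpos: "0 \<le> h i j" for i j
  proof -
    have "ln (max \<bar>x i - x j\<bar> (exp (- L))) \<le> C"
    proof (cases "\<bar>x i - x j\<bar> \<le> exp (- L)")
      case False
      then have "x i \<noteq> x j" by auto
      from shifted_kernel_offdiag(2)[OF this C(1)[OF x x]] False show ?thesis by (simp add: max_def)
    qed (use C in \<open>simp add: max_def\<close>)
    then show ?thesis by (simp add: h_def cutoff_kernel_def)
  qed
  have hj: "h j j = C + L" for j by (simp add: h_def cutoff_kernel_def)
  have hij: "(\<Sum>i<j. h i j) \<le> j * C - ln c - j * ln s" for j
  proof -
    have "(\<Sum>i<j. h i j) \<le> (\<Sum>i<j. C - ln \<bar>x j - x i\<bar>)"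
    proof (rule sum_mono)
      fix i assume "i \<in> {..<j}"
      then have "ln \<bar>x j - x i\<bar> \<le> ln (max \<bar>x j - x i\<bar> (exp (- L)))"
        using inj[of i j] by (subst ln_le_cancel_iff) (auto simp: less_max_iff_disj)
      then show "h i j \<le> C - ln \<bar>x j - x i\<bar>"
        by (simp add: h_def cutoff_kernel_def abs_minus_commute)
    qed
    also have "\<dots> = j * C - ln (\<Prod>i<j. \<bar>x j - x i\<bar>)"
      using inj[of _ j] by (subst ln_prod) (fastforce simp: sum_subtractf)+
    also have "\<dots> \<le> j * C - ln (c * s ^ j)"
      using leja[of j] cs ln_mono[of "c * s ^ j"] by simp
    also have "\<dots> = j * C - ln c - j * ln s" using cs by (simp add: ln_mult_pos ln_realpow)
    finally show ?thesis .
  qed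
  have S: "(\<Sum>i<M. \<Sum>j<M. h i j) \<le> M * (C + L - 2 * ln c) + real M * (real M - 1) * (C - ln s)" for M
  proof -
    have "(\<Sum>i<M. \<Sum>j<M. h i j) = (\<Sum>j<M. h j j + 2 * (\<Sum>i<j. h i j))"
      by (rule sum_square_symmetric) (simp add: h_def cutoff_kernel_def abs_minus_commute)
    also have "\<dots> \<le> (\<Sum>j<M. (C + L) + 2 * (j * C - ln c - j * ln s))"
      unfolding hj by (intro sum_mono add_left_mono mult_left_mono hij) simp
    also have "\<dots> = M * (C + L - 2 * ln c) + real M * (real M - 1) * (C - ln s)"
      by (induction M) (auto simp: algebra_simps)
    finally show ?thesis .
  qed
  have "(\<integral>\<^sup>+y. \<integral>\<^sup>+z. ennreal (cutoff_kernel C L y z) \<partial>empirical N \<partial>empirical N) =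
     (\<Sum>i<Suc N. (\<Sum>j<Suc N. ennreal (h i j)) / of_nat (Suc N)) / of_nat (Suc N)"
    by (simp add: nn_integral_empirical h_def del: sum.lessThan_Suc of_nat_Suc)
  also have "\<dots> = ennreal ((\<Sum>i<Suc N. \<Sum>j<Suc N. h i j) / (real (Suc N) * real (Suc N)))"
    using hpos
    by (simp add: sum_nonneg divide_ennreal ennreal_of_nat_eq_real_of_nat sum_divide_distrib
        del: sum.lessThan_Suc of_nat_Suc)
  also have "\<dots> \<le> ennreal ((C + L - 2 * ln c) / real (Suc N) + real N / real (Suc N) * (C - ln s))"
  proof (rule ennreal_leI)
    have "(\<Sum>i<Suc N. \<Sum>j<Suc N. h i j) / (real (Suc N) * real (Suc N)) \<le>
       (Suc N * (C + L - 2 * ln c) + real (Suc N) * (real (Suc N) - 1) * (C - ln s)) / (real (Suc N) * real (Suc N))"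
      by (intro divide_right_mono S) simp
    also have "\<dots> = (C + L - 2 * ln c) / real (Suc N) + real N / real (Suc N) * (C - ln s)"
      by (simp add: add_divide_distrib del: of_nat_Suc)
    finally show "(\<Sum>i<Suc N. \<Sum>j<Suc N. h i j) / (real (Suc N) * real (Suc N)) \<le>
      (C + L - 2 * ln c) / real (Suc N) + real N / real (Suc N) * (C - ln s)" .
  qed
  finally show ?thesis .
qed

lemma tight_empirical: "tight empirical"
proof -
  obtain B where B: "\<And>y. y \<in> K \<Longrightarrow> \<bar>y\<bar> \<le> B"
    using compact_imp_bounded[OF K] by (auto simp: bounded_iff)
  \<comment> \<open>The left end is \<open>- B - 1\<close> and not \<open>- B\<close> because
    \<open>tight\<close> is stated with intervals open on the left.\<close>
  have 1: "- B - 1 < B" using B[OF x[of 0]] by simp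
  have 2: "1 - \<epsilon> < measure (empirical n) {- B - 1<..B}" if "\<epsilon> > 0" for \<epsilon> n
  proof -
    interpret real_distribution "empirical n" by (rule real_distribution_empirical)
    have "AE y in empirical n. y \<in> {- B - 1<..B}"
      using empirical_AE by eventually_elim (use B in fastforce)
    then have "measure (empirical n) {- B - 1<..B} = 1" by (subst prob_eq_1) auto
    then show ?thesis using that by simp
  qed
  then show ?thesis unfolding tight_def using real_distribution_empirical 1 2 by blast
qed

text \<open>Tightness gives a weakly convergent subsequence, and Skorohod's theorem realises it by
  pointwise convergent random variables. Fatou's lemma bounds the energy of the limit for each fixed
  cutoff, and a second use of Fatou removes the cutoff.\<close>

lemma leja_energy:
  "\<exists>M \<in> prob_measures_on K. log_energy M \<le> ereal (- ln s)"
proof -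
  obtain r M where r: "strict_mono (r :: nat \<Rightarrow> nat)" and M: "real_distribution M"
    and w: "weak_conv_m (empirical \<circ> r) M"
    using tight_imp_convergent_subsubsequence[OF tight_empirical strict_mono_id] by auto
  interpret M: real_distribution M by fact
  have "real_distribution ((empirical \<circ> r) n)" for n
    by (simp add: real_distribution_empirical)
  from Skorohod[OF this M w] obtain \<Omega> :: "real measure" and Y Z where \<Omega>: "prob_space \<Omega>"
    and Y: "\<forall>n. Y n \<in> borel_measurable \<Omega>" and Yd: "\<forall>n. distr \<Omega> borel (Y n) = (empirical \<circ> r) n"
    and Z: "Z \<in> measurable \<Omega> lborel" and Zd: "distr \<Omega> borel Z = M"
    and lim: "\<forall>\<omega>\<in>space \<Omega>. (\<lambda>n. Y n \<omega>) \<longlonglongrightarrow> Z \<omega>"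
    by blast
  have [measurable]: "Y n \<in> borel_measurable \<Omega>" "Z \<in> borel_measurable \<Omega>" for n
    using Y Z by auto
  have Yd: "distr \<Omega> borel (Y n) = empirical (r n)" for n using Yd by simp
  have lim: "(\<lambda>n. Y n \<omega>) \<longlonglongrightarrow> Z \<omega>" if "\<omega> \<in> space \<Omega>" for \<omega> using lim that by blast
  interpret \<Omega>: prob_space \<Omega> by fact
  have Kb [measurable]: "K \<in> sets borel" by (rule borel_compact[OF K])
  have YK: "AE \<omega> in \<Omega>. \<forall>n. Y n \<omega> \<in> K"
    unfolding AE_all_countable
  proof
    fix n
    have "AE y in distr \<Omega> borel (Y n). y \<in> K" unfolding Yd by (rule empirical_AE)
    then show "AE \<omega> in \<Omega>. Y n \<omega> \<in> K" by (subst (asm) AE_distr_iff) auto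
  qed
  \<comment> \<open>\<open>K\<close> is closed, so the limit measure is again carried by
    \<open>K\<close>.\<close>
  have "AE \<omega> in \<Omega>. Z \<omega> \<in> K"
    using YK AE_space
    by eventually_elim (rule closed_sequentially[OF compact_imp_closed[OF K] _ lim]; simp)
  then have AEK: "AE y in M. y \<in> K" unfolding Zd[symmetric] by (subst AE_distr_iff) auto
  then have "emeasure M K = 1"
    using M.prob_space M.AE_in_set_eq_1[of K] by (simp add: M.emeasure_eq_measure)
  then have MK: "M \<in> prob_measures_on K"
    by (simp add: prob_measures_on_def M.prob_space_axioms)
  obtain C0 where C0: "\<And>x y. x \<in> K \<Longrightarrow> y \<in> K \<Longrightarrow> log_kernel_neg x y \<le> C0"
    using log_kernel_neg_bounded[OF compact_imp_bounded[OF K]] by metis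
  \<comment> \<open>The entry 0 is required by \<open>cutoff_energy_empirical\<close>, the entry
    \<open>ln s\<close> makes the limiting bound \<open>C - ln s\<close> nonnegative.\<close>
  define C where "C = max 0 (max C0 (ln s))"
  have C: "log_kernel_neg x y \<le> C" if "x \<in> K" "y \<in> K" for x y
    using C0[OF that] by (auto simp: C_def)
  have C': "C \<ge> 0" "C \<ge> ln s" by (auto simp: C_def)
  define g where "g L y z = ennreal (cutoff_kernel C L y z)" for L y z
  have [measurable]: "case_prod (g L) \<in> borel_measurable (borel \<Otimes>\<^sub>M borel)" for L
    unfolding g_def case_prod_beta by measurable
  have cut: "(\<integral>\<^sup>+y. \<integral>\<^sup>+z. g L y z \<partial>M \<partial>M) \<le> ennreal (C - ln s)" if L: "L \<ge> 0" for L
  proof -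
    have tg: "(\<lambda>n. g L (Y n \<omega>) (Y n \<omega>')) \<longlonglongrightarrow> g L (Z \<omega>) (Z \<omega>')"
      if "\<omega> \<in> space \<Omega>" "\<omega>' \<in> space \<Omega>" for \<omega> \<omega>'
      unfolding g_def by (intro tendsto_ennrealI tendsto_cutoff_kernel lim that)
    \<comment> \<open>The two variables of the energy are the same random variable at two separate
      sample points, so pointwise convergence of \<open>Y\<close> serves both and no weak
      convergence of product measures is required.\<close>
    have "(\<integral>\<^sup>+y. \<integral>\<^sup>+z. g L y z \<partial>M \<partial>M) = (\<integral>\<^sup>+\<omega>. \<integral>\<^sup>+\<omega>'. g L (Z \<omega>) (Z \<omega>') \<partial>\<Omega> \<partial>\<Omega>)"
      unfolding Zd[symmetric] by (simp add: nn_integral_distr)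
    also have "\<dots> = (\<integral>\<^sup>+\<omega>. \<integral>\<^sup>+\<omega>'. liminf (\<lambda>n. g L (Y n \<omega>) (Y n \<omega>')) \<partial>\<Omega> \<partial>\<Omega>)"
      using tg by (intro nn_integral_cong lim_imp_Liminf[symmetric]) auto
    also have "\<dots> \<le> (\<integral>\<^sup>+\<omega>. liminf (\<lambda>n. \<integral>\<^sup>+\<omega>'. g L (Y n \<omega>) (Y n \<omega>') \<partial>\<Omega>) \<partial>\<Omega>)"
      by (intro nn_integral_mono nn_integral_liminf) measurable
    also have "\<dots> \<le> liminf (\<lambda>n. \<integral>\<^sup>+\<omega>. \<integral>\<^sup>+\<omega>'. g L (Y n \<omega>) (Y n \<omega>') \<partial>\<Omega> \<partial>\<Omega>)"
      by (intro nn_integral_liminf) measurable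
    also have "(\<lambda>n. \<integral>\<^sup>+\<omega>. \<integral>\<^sup>+\<omega>'. g L (Y n \<omega>) (Y n \<omega>') \<partial>\<Omega> \<partial>\<Omega>) =
        (\<lambda>n. \<integral>\<^sup>+y. \<integral>\<^sup>+z. g L y z \<partial>empirical (r n) \<partial>empirical (r n))"
      unfolding Yd[symmetric] by (simp add: nn_integral_distr)
    also have "liminf \<dots> \<le> liminf (\<lambda>n. ennreal ((C + L - 2 * ln c) / real (Suc (r n)) +
        real (r n) / real (Suc (r n)) * (C - ln s)))"
      unfolding g_def by (intro Liminf_mono always_eventually allI cutoff_energy_empirical C C' L)
    also have "\<dots> = ennreal (C - ln s)"
    proof (rule lim_imp_Liminf)
      have "(\<lambda>n. (C + L - 2 * ln c) / real (Suc n) + real n / real (Suc n) * (C - ln s)) \<longlonglongrightarrow> C - ln s"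
        by real_asymp
      from tendsto_ennrealI[OF LIMSEQ_subseq_LIMSEQ[OF this r]]
      show "(\<lambda>n. ennreal ((C + L - 2 * ln c) / real (Suc (r n)) +
        real (r n) / real (Suc (r n)) * (C - ln s))) \<longlonglongrightarrow> ennreal (C - ln s)"
        by (simp add: o_def)
    qed simp
    finally show ?thesis .
  qed
  have "(\<integral>\<^sup>+y. \<integral>\<^sup>+z. shifted_kernel C y z \<partial>M \<partial>M) \<le>
      (\<integral>\<^sup>+y. \<integral>\<^sup>+z. liminf (\<lambda>n. g (real n) y z) \<partial>M \<partial>M)"
    using AEK
    by (intro nn_integral_mono_AE; eventually_elim)
      (intro nn_integral_mono_AE; use AEK in eventually_elim;
       auto simp: g_def intro!: shifted_kernel_le_liminf_cutoff C)
  also have "\<dots> \<le> (\<integral>\<^sup>+y. liminf (\<lambda>n. \<integral>\<^sup>+z. g (real n) y z \<partial>M) \<partial>M)"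
    by (intro nn_integral_mono nn_integral_liminf) measurable
  also have "\<dots> \<le> liminf (\<lambda>n. \<integral>\<^sup>+y. \<integral>\<^sup>+z. g (real n) y z \<partial>M \<partial>M)"
    by (intro nn_integral_liminf) measurable
  also have "\<dots> \<le> liminf (\<lambda>n::nat. ennreal (C - ln s))"
    by (intro Liminf_mono always_eventually allI cut) simp
  also have "\<dots> = ennreal (C + (- ln s))" by (simp add: Liminf_const)
  finally have "log_energy M \<le> ereal (- ln s)"
    using C' by (subst log_energy_le_iff[OF MK K C]) auto
  then show ?thesis using MK by blast
qed

end

text \<open>Choose the points greedily: \<open>x N\<close> is a point where the monic polynomial
  with roots \<open>x 0\<close> to \<open>x (N - 1)\<close> is large.\<close>

lemma exists_energy_le:
  assumes K: "compact K" and "c > 0" "s > 0"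
    and big: "\<And>p :: real poly. lead_coeff p = 1 \<Longrightarrow> \<exists>y\<in>K. c * s ^ degree p \<le> \<bar>poly p y\<bar>"
  shows "\<exists>M \<in> prob_measures_on K. log_energy M \<le> ereal (- ln s)"
proof -
  have "\<exists>x. \<forall>N. x N \<in> K \<and> c * s ^ N \<le> (\<Prod>i<N. \<bar>x N - x i\<bar>)"
  proof (rule dependent_wf_choice[of less_than])
    fix N and x :: "nat \<Rightarrow> real"
    show "\<exists>r. r \<in> K \<and> c * s ^ N \<le> (\<Prod>i<N. \<bar>r - x i\<bar>)"
      using big[of "\<Prod>i<N. [:- x i, 1:]", OF lead_coeff_prod_linear_factors]
      by (auto simp: degree_prod_linear_factors poly_prod_linear_factors abs_prod)
  qed auto
  then show ?thesis using leja_energy[OF K] assms(2,3) by blast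
qed

section \<open>Chebyshev numbers and capacity\<close>

definition cheb1 :: "real set \<Rightarrow> nat \<Rightarrow> real" where
  "cheb1 K m = (INF p\<in>{p :: complex poly. degree p = m \<and> lead_coeff p = 1}.
     SUP x\<in>K. cmod (poly p (of_real x)))"

lemma continuous_on_cmod_poly: "continuous_on K (\<lambda>x. cmod (poly p (of_real x)))"
  by (intro continuous_intros)

lemma bdd_above_cmod_poly:
  assumes "compact (K :: real set)"
  shows "bdd_above ((\<lambda>x. cmod (poly p (of_real x))) ` K)"
  by (intro bounded_imp_bdd_above compact_imp_bounded compact_continuous_image continuous_on_cmod_poly assms)

lemma cheb1_le:
  assumes K: "compact K" "K \<noteq> {}" and p: "degree p = m" "lead_coeff p = 1"
    and B: "\<And>x. x \<in> K \<Longrightarrow> cmod (poly p (of_real x)) \<le> B"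
  shows "cheb1 K m \<le> B"
proof -
  obtain x0 where x0: "x0 \<in> K" using K by auto
  have "cheb1 K m \<le> (SUP x\<in>K. cmod (poly p (of_real x)))"
    unfolding cheb1_def
  proof (rule cINF_lower)
    show "bdd_below ((\<lambda>p. SUP x\<in>K. cmod (poly p (of_real x))) `
        {p :: complex poly. degree p = m \<and> lead_coeff p = 1})"
    proof (rule bdd_belowI2[where m = 0])
      fix q :: "complex poly"
      show "0 \<le> (SUP x\<in>K. cmod (poly q (of_real x)))"
        using cSUP_upper[OF x0 bdd_above_cmod_poly[OF K(1), of q]] norm_ge_zero order_trans by blast
    qed
  qed (use p in auto)
  also have "\<dots> \<le> B" by (rule cSUP_least) (use K B in auto)
  finally show ?thesis .
qed

lemma cheb1_geI:
  assumes "compact K"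
    and "\<And>p. degree p = m \<Longrightarrow> lead_coeff p = 1 \<Longrightarrow> \<exists>x\<in>K. L \<le> cmod (poly p (of_real x))"
  shows "L \<le> cheb1 K m"
  unfolding cheb1_def
proof (rule cINF_greatest)
  have "monom (1::complex) m \<in> {p. degree p = m \<and> lead_coeff p = 1}" by (simp add: degree_monom_eq)
  then show "{p :: complex poly. degree p = m \<and> lead_coeff p = 1} \<noteq> {}" by blast
next
  fix p :: "complex poly" assume "p \<in> {p. degree p = m \<and> lead_coeff p = 1}"
  then obtain x where "x \<in> K" "L \<le> cmod (poly p (of_real x))" using assms(2)[of p] by auto
  then show "L \<le> (SUP x\<in>K. cmod (poly p (of_real x)))"
    using cSUP_upper[OF _ bdd_above_cmod_poly[OF assms(1)]] order_trans by blast
qed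

lemma cheb1_ex_point:
  assumes K: "compact K" "K \<noteq> {}" and "degree p = m" "lead_coeff p = 1"
  shows "\<exists>x\<in>K. cheb1 K m \<le> cmod (poly p (of_real x))"
proof -
  obtain x where "x \<in> K" "\<And>y. y \<in> K \<Longrightarrow> cmod (poly p (of_real y)) \<le> cmod (poly p (of_real x))"
    using continuous_attains_sup[OF K continuous_on_cmod_poly] by blast
  then show ?thesis using cheb1_le[OF assms] by blast
qed

lemma cheb1_less:
  assumes K: "compact K" "K \<noteq> {}" and p: "degree p = m" "lead_coeff p = 1"
    and B: "\<And>x. x \<in> K \<Longrightarrow> cmod (poly p (of_real x)) < B"
  shows "cheb1 K m < B"
  using cheb1_ex_point[OF K p] B by force

lemma cheb1_0:
  assumes "compact K" "K \<noteq> {}"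
  shows "cheb1 K 0 = 1"
proof (rule antisym)
  show "cheb1 K 0 \<le> 1" by (rule cheb1_le[where p = 1]) (use assms in auto)
  show "1 \<le> cheb1 K 0"
  proof (rule cheb1_geI)
    fix p :: "complex poly" assume p: "degree p = 0" "lead_coeff p = 1"
    then have "p = 1" by (metis degree_eq_zeroE coeff_pCons_0 one_pCons)
    then show "\<exists>x\<in>K. 1 \<le> cmod (poly p (of_real x))" using assms by auto
  qed fact
qed

section \<open>Passing between complex and real coefficients, and the two capacity criteria\<close>

lemma poly_altdef_le:
  fixes p :: "'a::comm_semiring_1 poly"
  assumes "degree p \<le> n"
  shows "poly p x = (\<Sum>i\<le>n. coeff p i * x ^ i)"
  unfolding poly_altdef using assms
  by (intro sum.mono_neutral_left) (auto simp: coeff_eq_0)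

text \<open>On the real line this is the real part of the values, so it does not increase the norm
  on a real set, and it keeps monic polynomials monic.\<close>

definition poly_Re :: "complex poly \<Rightarrow> real poly" where
  "poly_Re p = map_poly Re p"

lemma coeff_poly_Re [simp]: "coeff (poly_Re p) k = Re (coeff p k)"
  by (simp add: poly_Re_def coeff_map_poly)

lemma degree_poly_Re_le: "degree (poly_Re p) \<le> degree p"
  by (simp add: poly_Re_def map_poly_degree_leq)

lemma poly_poly_Re: "poly (poly_Re p) x = Re (poly p (of_real x))"
proof -
  have "poly (poly_Re p) x = (\<Sum>i\<le>degree p. coeff (poly_Re p) i * x ^ i)"
    using degree_poly_Re_le by (rule poly_altdef_le)
  also have "\<dots> = Re (poly p (of_real x))"
    by (simp add: poly_altdef flip: of_real_power)
  finally show ?thesis .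
qed

lemma monic_poly_Re:
  assumes "lead_coeff p = 1"
  shows "degree (poly_Re p) = degree p" "lead_coeff (poly_Re p) = 1"
proof -
  have "coeff (poly_Re p) (degree p) \<noteq> 0" using assms by simp
  then show 1: "degree (poly_Re p) = degree p"
    by (intro antisym degree_poly_Re_le le_degree)
  show "lead_coeff (poly_Re p) = 1" unfolding 1 using assms by simp
qed

definition poly_cplx :: "real poly \<Rightarrow> complex poly" where
  "poly_cplx p = map_poly of_real p"

lemma coeff_poly_cplx [simp]: "coeff (poly_cplx p) k = of_real (coeff p k)"
  by (simp add: poly_cplx_def coeff_map_poly)

lemma degree_poly_cplx [simp]: "degree (poly_cplx p) = degree p"
  unfolding poly_cplx_def by (rule degree_map_poly) simp

lemma poly_poly_cplx [simp]: "poly (poly_cplx p) (of_real x) = of_real (poly p x)"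
  by (simp add: poly_altdef)

lemma log_energy_lower_bound_complex:
  fixes p :: "nat \<Rightarrow> complex poly"
  assumes "compact K" "M \<in> prob_measures_on K" "\<tau> > 0" "D \<ge> 1"
    and p: "\<And>k. degree (p k) = k" "\<And>k. lead_coeff (p k) = 1"
      "\<And>k x. x \<in> K \<Longrightarrow> cmod (poly (p k) (of_real x)) \<le> D * \<tau> ^ k"
  shows "ereal (- ln \<tau>) \<le> log_energy M"
proof (rule log_energy_lower_bound[where p = "\<lambda>k. poly_Re (p k)"])
  show "degree (poly_Re (p k)) = k" "lead_coeff (poly_Re (p k)) = 1" for k
    using monic_poly_Re[OF p(2)] by (auto simp: p(1))
  show "\<bar>poly (poly_Re (p k)) x\<bar> \<le> D * \<tau> ^ k" if "x \<in> K" for k x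
    using p(3)[OF that] abs_Re_le_cmod order_trans unfolding poly_poly_Re by blast
qed fact+

lemma log_cap_le:
  fixes p :: "nat \<Rightarrow> complex poly"
  assumes "compact K" "\<tau> > 0" "D \<ge> 1"
    and "\<And>k. degree (p k) = k" "\<And>k. lead_coeff (p k) = 1"
      "\<And>k x. x \<in> K \<Longrightarrow> cmod (poly (p k) (of_real x)) \<le> D * \<tau> ^ k"
  shows "log_cap K \<le> \<tau>"
proof -
  have "ereal (- ln \<tau>) \<le> robin_const K"
    unfolding robin_const_def
    by (rule INF_greatest) (rule log_energy_lower_bound_complex[OF assms(1) _ assms(2-)])
  then show ?thesis
  proof (cases "robin_const K")
    case (real r)
    with \<open>ereal (- ln \<tau>) \<le> robin_const K\<close> have "exp (- r) \<le> exp (ln \<tau>)" by simp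
    with real assms(2) show ?thesis by (simp add: log_cap_def)
  qed (use \<open>ereal (- ln \<tau>) \<le> robin_const K\<close> assms(2) in \<open>auto simp: log_cap_def\<close>)
qed

text \<open>The monomials already give a finite lower bound for the energy on a bounded set. This
  excludes the case in which \<open>real_of_ereal\<close> in \<open>log_cap\<close> would return its
  default value 0.\<close>

lemma robin_const_gt_minus_infinity:
  assumes "compact K"
  shows "robin_const K \<noteq> -\<infinity>"
proof -
  obtain B where B: "\<And>x. x \<in> K \<Longrightarrow> \<bar>x\<bar> \<le> B"
    using compact_imp_bounded[OF assms] by (auto simp: bounded_iff)
  have "ereal (- ln (max 1 B)) \<le> robin_const K"
    unfolding robin_const_def
  proof (rule INF_greatest, rule log_energy_lower_bound_complex[where p = "\<lambda>k. monom 1 k" and D = 1])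
    show "cmod (poly (monom 1 k) (complex_of_real x)) \<le> 1 * max 1 B ^ k" if "x \<in> K" for k x
      using B[OF that] by (auto simp: poly_monom norm_power intro!: power_mono)
  qed (use assms in \<open>auto simp: degree_monom_eq\<close>)
  then show ?thesis by auto
qed

lemma non_polar_nonempty: "non_polar K \<Longrightarrow> K \<noteq> {}"
  by (auto simp: non_polar_def log_cap_def robin_const_def prob_measures_on_def top_ereal_def)

text \<open>Counterpart of \<open>log_cap_le\<close>: the lower bound for Chebyshev numbers feeds
  the greedy choice of points, and the resulting measure bounds the Robin constant from
  above.\<close>

lemma log_cap_ge:
  assumes K: "compact K" "non_polar K" and "c > 0" "s > 0"
    and "\<And>k. c * s ^ k \<le> cheb1 K k"
  shows "s \<le> log_cap K"
proof -
  have ne: "K \<noteq> {}" using K non_polar_nonempty by blast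
  have "\<exists>M \<in> prob_measures_on K. log_energy M \<le> ereal (- ln s)"
  proof (rule exists_energy_le[OF K(1) assms(3,4)])
    fix p :: "real poly" assume "lead_coeff p = 1"
    then obtain y where "y \<in> K" "cheb1 K (degree p) \<le> cmod (poly (poly_cplx p) (of_real y))"
      using cheb1_ex_point[OF K(1) ne, of "poly_cplx p"] by auto
    then show "\<exists>y\<in>K. c * s ^ degree p \<le> \<bar>poly p y\<bar>"
      using assms(5)[of "degree p"] by (intro bexI[of _ y]) auto
  qed
  then have "robin_const K \<le> ereal (- ln s)"
    unfolding robin_const_def by (meson INF_lower2)
  moreover have "robin_const K \<noteq> \<infinity>" using calculation by auto
  ultimately have "ln s \<le> - real_of_ereal (robin_const K)"
    using robin_const_gt_minus_infinity[OF K(1)] by (cases "robin_const K") auto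
  then have "exp (ln s) \<le> log_cap K"
    using \<open>robin_const K \<noteq> \<infinity>\<close> by (simp add: log_cap_def del: exp_ln exp_ln_iff)
  then show ?thesis using assms by simp
qed

section \<open>Chebyshev polynomials of a polynomial, and the factor 2\<close>

text \<open>For \<^term>\<open>poly T z = t * cos \<theta>\<close> the value at \<^term>\<open>z\<close> is
  \<^term>\<open>2 * (t / 2) ^ a * cos (a * \<theta>)\<close>: these are Chebyshev polynomials of \<open>[-t,t]\<close>
  composed with \<^term>\<open>T\<close>, normalised to be monic for \<^term>\<open>a \<ge> 1\<close>.\<close>

fun cheb_comp :: "complex poly \<Rightarrow> real \<Rightarrow> nat \<Rightarrow> complex poly" where
  "cheb_comp T t 0 = 2"
| "cheb_comp T t (Suc 0) = T"
| "cheb_comp T t (Suc (Suc a)) = T * cheb_comp T t (Suc a) - smult (of_real (t\<^sup>2 / 4)) (cheb_comp T t a)"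

lemma poly_cheb_comp:
  assumes "poly T z = of_real (t * cos \<theta>)"
  shows "poly (cheb_comp T t a) z = of_real (2 * (t / 2) ^ a * cos (a * \<theta>))"
proof (induction a rule: induct_nat_012)
  case (ge2 a)
  have "cos (real (Suc (Suc a)) * \<theta>) + cos (a * \<theta>) = 2 * cos \<theta> * cos (real (Suc a) * \<theta>)"
    using cos_add[of "real (Suc a) * \<theta>" \<theta>] cos_diff[of "real (Suc a) * \<theta>" \<theta>]
    by (simp add: algebra_simps)
  then have eq: "cos (real (Suc (Suc a)) * \<theta>) = 2 * cos \<theta> * cos (real (Suc a) * \<theta>) - cos (a * \<theta>)"
    by linarith
  have "poly (cheb_comp T t (Suc (Suc a))) z =
      of_real ((t * cos \<theta>) * (2 * (t / 2) ^ Suc a * cos (real (Suc a) * \<theta>))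
        - t\<^sup>2 / 4 * (2 * (t / 2) ^ a * cos (a * \<theta>)))"
    using ge2 assms by simp
  also have "(t * cos \<theta>) * (2 * (t / 2) ^ Suc a * cos (real (Suc a) * \<theta>))
        - t\<^sup>2 / 4 * (2 * (t / 2) ^ a * cos (a * \<theta>)) =
      2 * (t / 2) ^ Suc (Suc a) * cos (real (Suc (Suc a)) * \<theta>)"
    unfolding eq by (simp add: power2_eq_square field_simps)
  finally show ?case .
qed (use assms in auto)

text \<open>Degree bound and top coefficient are stated separately because the start of the
  recursion, the constant 2, is not monic.\<close>

lemma cheb_comp_monic:
  assumes "degree T = m" "lead_coeff T = 1" "m \<ge> 1"
  shows "degree (cheb_comp T t a) \<le> a * m \<and> (a \<ge> 1 \<longrightarrow> coeff (cheb_comp T t a) (a * m) = 1)"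
proof (induction a rule: induct_nat_012)
  case (ge2 a)
  have 1: "degree (T * cheb_comp T t (Suc a)) \<le> Suc (Suc a) * m"
    using degree_mult_le[of T "cheb_comp T t (Suc a)"] ge2 assms by auto
  have 2: "degree (smult (of_real (t\<^sup>2 / 4)) (cheb_comp T t a)) \<le> a * m"
    using ge2 order_trans[OF degree_smult_le] by blast
  have 3: "a * m < Suc (Suc a) * m" using assms by simp
  have "degree (cheb_comp T t (Suc a)) = Suc a * m"
    using ge2 by (intro antisym le_degree) auto
  then have "coeff (T * cheb_comp T t (Suc a)) (Suc (Suc a) * m) = 1"
    using coeff_mult_degree_sum[of T "cheb_comp T t (Suc a)"] ge2 assms by simp
  moreover have "coeff (smult (of_real (t\<^sup>2 / 4)) (cheb_comp T t a)) (Suc (Suc a) * m) = 0"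
    using 2 3 by (intro coeff_eq_0) linarith
  moreover have "degree (cheb_comp T t (Suc (Suc a))) \<le> Suc (Suc a) * m"
    using 1 2 3 by (auto intro!: degree_diff_le)
  ultimately show ?case by simp
qed (use assms in auto)

lemma cheb_comp_degree:
  assumes "degree T = m" "lead_coeff T = 1" "m \<ge> 1" "a \<ge> 1"
  shows "degree (cheb_comp T t a) = a * m" "lead_coeff (cheb_comp T t a) = 1"
proof -
  show 1: "degree (cheb_comp T t a) = a * m"
    using cheb_comp_monic[OF assms(1-3), of t a] assms by (intro antisym le_degree) auto
  show "lead_coeff (cheb_comp T t a) = 1"
    unfolding 1 using cheb_comp_monic[OF assms(1-3), of t a] assms by simp
qed

lemma cheb_comp_bound:
  assumes "poly T z = of_real y" "\<bar>y\<bar> \<le> t" "t > 0"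
  shows "cmod (poly (cheb_comp T t a) z) \<le> 2 * (t / 2) ^ a"
proof -
  have "y = t * cos (arccos (y / t))"
    using assms by (subst cos_arccos) (auto simp: field_simps)
  then have "poly T z = of_real (t * cos (arccos (y / t)))" using assms(1) by simp
  note eq = poly_cheb_comp[OF this]
  show ?thesis
    unfolding eq norm_of_real using assms(3)
    by (simp add: abs_mult power_abs mult_left_le)
qed

text \<open>The composed Chebyshev polynomials have norm at most \<open>2 * (t / 2) ^ a\<close> in
  degree \<open>a * m\<close>. Multiplying by a monomial of degree below \<open>m\<close> fills the
  remaining degrees at the cost of a bounded factor, so \<open>log_cap_le\<close> applies with the
  \<open>m\<close>-th root of \<open>t / 2\<close>.\<close>

lemma log_cap_power_le:
  fixes T :: "complex poly"
  assumes K: "compact K" and T: "degree T = m" "lead_coeff T = 1" "m \<ge> 1"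
    and t: "t > 0" "\<And>x. x \<in> K \<Longrightarrow> \<exists>y. \<bar>y\<bar> \<le> t \<and> poly T (of_real x) = of_real y"
  shows "log_cap K ^ m \<le> t / 2"
proof -
  define \<tau> where "\<tau> = root m (t / 2)"
  have \<tau>: "\<tau> > 0" "\<tau> ^ m = t / 2" using T t by (auto simp: \<tau>_def)
  obtain B where B: "\<And>x. x \<in> K \<Longrightarrow> \<bar>x\<bar> \<le> B"
    using compact_imp_bounded[OF K] by (auto simp: bounded_iff)
  \<comment> \<open>\<open>R\<close> absorbs the monomial factors: a power below \<open>m\<close>
    costs at most \<open>R ^ m\<close> relative to the matching power of
    \<open>\<tau>\<close>.\<close>
  define R where "R = max 1 (B / \<tau>)"
  have R: "R \<ge> 1" "\<And>x. x \<in> K \<Longrightarrow> \<bar>x\<bar> \<le> R * \<tau>"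
  proof -
    fix x assume "x \<in> K"
    then have "\<bar>x\<bar> \<le> B / \<tau> * \<tau>" using B \<tau> by simp
    also have "\<dots> \<le> R * \<tau>" using \<tau> unfolding R_def by (intro mult_right_mono) auto
    finally show "\<bar>x\<bar> \<le> R * \<tau>" .
  qed (simp add: R_def)
  define p where "p k = (if k < m then monom 1 k else cheb_comp T t (k div m) * monom 1 (k mod m))" for k
  have deg: "degree (cheb_comp T t (k div m)) = (k div m) * m" "lead_coeff (cheb_comp T t (k div m)) = 1"
    if "k \<ge> m" for k
    using cheb_comp_degree[OF T, of "k div m" t] that T by (auto simp: div_greater_zero_iff Suc_leI)
  have "log_cap K \<le> \<tau>"
  proof (rule log_cap_le[OF K \<tau>(1), of "2 * R ^ m" p])
    show "1 \<le> 2 * R ^ m" using one_le_power[OF R(1), of m] by linarith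
    show "lead_coeff (p k) = 1" for k
      using deg[of k] by (auto simp: p_def lead_coeff_mult degree_monom_eq)
    show "degree (p k) = k" for k
    proof (cases "k < m")
      case False
      then have "cheb_comp T t (k div m) \<noteq> 0" using deg[of k] by auto
      then show ?thesis using False deg[of k]
        by (simp add: p_def degree_mult_eq degree_monom_eq monom_eq_0_iff)
    qed (simp add: p_def degree_monom_eq)
    show "cmod (poly (p k) (of_real x)) \<le> 2 * R ^ m * \<tau> ^ k" if x: "x \<in> K" for k x
    proof -
      have mono: "cmod (of_real x) ^ j \<le> R ^ m * \<tau> ^ j" if "j < m" for j
      proof -
        have "cmod (of_real x) ^ j \<le> (R * \<tau>) ^ j" using R(2)[OF x] by (intro power_mono) auto
        also have "\<dots> = R ^ j * \<tau> ^ j" by (simp add: power_mult_distrib)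
        also have "\<dots> \<le> R ^ m * \<tau> ^ j"
          using R(1) \<tau> that by (intro mult_right_mono power_increasing) auto
        finally show ?thesis .
      qed
      show ?thesis
      proof (cases "k < m")
        case True
        have "R ^ m * \<tau> ^ k \<ge> 0" using R \<tau> by simp
        then show ?thesis using mono[OF True] True by (simp add: p_def poly_monom norm_power)
      next
        case False
        obtain y where y: "\<bar>y\<bar> \<le> t" "poly T (of_real x) = of_real y" using t(2)[OF x] by auto
        have "cmod (poly (p k) (of_real x)) =
            cmod (poly (cheb_comp T t (k div m)) (of_real x)) * cmod (of_real x) ^ (k mod m)"
          using False by (simp add: p_def poly_monom norm_mult norm_power)
        also have "\<dots> \<le> (2 * (t / 2) ^ (k div m)) * (R ^ m * \<tau> ^ (k mod m))"
          using T t by (intro mult_mono mono cheb_comp_bound[OF y(2,1)]) auto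
        also have "\<dots> = 2 * R ^ m * \<tau> ^ (m * (k div m) + k mod m)"
          by (simp only: power_add power_mult \<tau>(2) mult_ac)
        finally show ?thesis by simp
      qed
    qed
  qed
  then have "log_cap K ^ m \<le> \<tau> ^ m"
    by (intro power_mono) (auto simp: log_cap_def)
  with \<tau> show ?thesis by simp
qed

text \<open>A monic polynomial with smaller norm could be made real by \<open>poly_Re\<close>, and
  \<open>log_cap_power_le\<close> would then contradict its norm.\<close>

lemma cheb1_ge_log_cap:
  assumes K: "compact K" "non_polar K" and "m \<ge> 1"
  shows "2 * log_cap K ^ m \<le> cheb1 K m"
proof (rule cheb1_geI[OF K(1)], rule ccontr)
  fix p :: "complex poly"
  assume p: "degree p = m" "lead_coeff p = 1"
    and "\<not> (\<exists>x\<in>K. 2 * log_cap K ^ m \<le> cmod (poly p (of_real x)))"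
  then have less: "cmod (poly p (of_real x)) < 2 * log_cap K ^ m" if "x \<in> K" for x
    using that by (auto simp: not_le)
  have ne: "K \<noteq> {}" using K non_polar_nonempty by blast
  obtain x0 where x0: "x0 \<in> K" "\<And>y. y \<in> K \<Longrightarrow> cmod (poly p (of_real y)) \<le> cmod (poly p (of_real x0))"
    using continuous_attains_sup[OF K(1) ne continuous_on_cmod_poly] by blast
  \<comment> \<open>The maximum keeps \<open>t\<close> positive even if \<open>p\<close> vanishes on
    \<open>K\<close>, and \<open>t\<close> stays below \<open>2 * log_cap K ^ m\<close>.\<close>
  define t where "t = max (cmod (poly p (of_real x0))) (log_cap K ^ m)"
  have cpos: "log_cap K ^ m > 0" using K by (simp add: non_polar_def)
  have "t < 2 * log_cap K ^ m" using less[OF x0(1)] cpos by (auto simp: t_def)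
  moreover have "log_cap K ^ m \<le> t / 2"
  proof (rule log_cap_power_le[where T = "poly_cplx (poly_Re p)"])
    show "degree (poly_cplx (poly_Re p)) = m" "lead_coeff (poly_cplx (poly_Re p)) = 1"
      using monic_poly_Re[OF p(2)] p by auto
    show "t > 0" using cpos by (auto simp: t_def less_max_iff_disj)
    show "\<exists>y. \<bar>y\<bar> \<le> t \<and> poly (poly_cplx (poly_Re p)) (of_real x) = of_real y" if "x \<in> K" for x
    proof (intro exI conjI)
      show "\<bar>poly (poly_Re p) x\<bar> \<le> t"
        using x0(2)[OF that] abs_Re_le_cmod[of "poly p (of_real x)"] unfolding poly_poly_Re t_def by linarith
    qed (rule poly_poly_cplx)
  qed fact+
  ultimately show False by simp
qed

section \<open>The equality case\<close>

text \<open>Serves the compactness argument for extremal polynomials, with \<open>X\<close> a finite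
  set of interpolation nodes.\<close>

lemma common_convergent_subsequence:
  fixes f :: "'b \<Rightarrow> nat \<Rightarrow> 'a::heine_borel"
  assumes "finite X" "\<And>x. x \<in> X \<Longrightarrow> bounded (range (f x))"
  shows "\<exists>r :: nat \<Rightarrow> nat. strict_mono r \<and> (\<forall>x\<in>X. convergent (f x \<circ> r))"
  using assms
proof (induction X)
  case empty
  then show ?case using strict_mono_id by blast
next
  case (insert a X)
  have "\<exists>r :: nat \<Rightarrow> nat. strict_mono r \<and> (\<forall>x\<in>X. convergent (f x \<circ> r))"
    by (rule insert.IH) (rule insert.prems, simp)
  then obtain r :: "nat \<Rightarrow> nat" where r: "strict_mono r" "\<And>x. x \<in> X \<Longrightarrow> convergent (f x \<circ> r)"
    by auto
  have "bounded (range (f a \<circ> r))"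
    by (rule bounded_subset[OF insert.prems[of a]]) auto
  from bounded_imp_convergent_subsequence[OF this]
  obtain l s where s: "strict_mono (s :: nat \<Rightarrow> nat)" "(f a \<circ> r \<circ> s) \<longlonglongrightarrow> l"
    by (auto simp: o_assoc)
  have conv: "convergent (f x \<circ> (r \<circ> s))" if "x \<in> insert a X" for x
  proof (cases "x = a")
    case True
    then show ?thesis using s(2) by (auto simp: convergent_def o_assoc)
  next
    case False
    then show ?thesis
      using convergent_subseq_convergent[OF r(2) s(1), of x] that by (simp add: o_assoc)
  qed
  show ?case
    by (rule exI[of _ "r \<circ> s"], rule conjI, rule strict_mono_o[OF r(1) s(1)], rule ballI, rule conv)
qed

text \<open>The polynomial vanishing on a finite \<open>K\<close> would make a Chebyshev number 0,
  against the positive lower bound. Infinitely many points supply interpolation nodes for every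
  degree.\<close>

lemma non_polar_infinite:
  assumes K: "compact K" "non_polar K"
  shows "infinite K"
proof
  assume fin: "finite K"
  have ne: "K \<noteq> {}" using K non_polar_nonempty by blast
  then have "2 * log_cap K ^ card K \<le> cheb1 K (card K)"
    using fin K by (intro cheb1_ge_log_cap) (auto simp: Suc_le_eq card_gt_0_iff)
  also have "\<dots> \<le> 0"
  proof (rule cheb1_le[OF K(1) ne, where p = "\<Prod>y\<in>K. [:- of_real y, 1:]"])
    show "cmod (poly (\<Prod>y\<in>K. [:- of_real y, 1:]) (of_real x)) \<le> 0" if "x \<in> K" for x
      using that fin by (auto simp: poly_prod_linear_factors)
  qed (rule degree_prod_linear_factors lead_coeff_prod_linear_factors)+
  finally show False using K(2) by (auto simp: non_polar_def dest: zero_less_power[of _ "card K"])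
qed

text \<open>A minimising sequence is bounded at \<open>m + 1\<close> nodes of \<open>K\<close>. A
  subsequence converges at all nodes, and Lagrange interpolation turns this into convergence of
  every coefficient.\<close>

lemma cheb1_attained:
  assumes K: "compact K" "infinite K"
  shows "\<exists>p. degree p = m \<and> lead_coeff p = 1 \<and> (\<forall>x\<in>K. cmod (poly p (of_real x)) \<le> cheb1 K m)"
proof -
  have "\<exists>p. degree p = m \<and> lead_coeff p = 1 \<and>
      (\<forall>x\<in>K. cmod (poly p (of_real x)) < cheb1 K m + 1 / real (Suc i))" for i
  proof (rule ccontr)
    define Q where "Q p \<longleftrightarrow> degree p = m \<and> lead_coeff p = 1 \<and>
      (\<forall>x\<in>K. cmod (poly p (of_real x)) < cheb1 K m + 1 / real (Suc i))" for p
    assume "\<not> ?thesis"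
    then have no: "\<not> Q p" for p unfolding Q_def[symmetric] by simp
    have "cheb1 K m + 1 / real (Suc i) \<le> cheb1 K m"
    proof (rule cheb1_geI[OF K(1)])
      fix p :: "complex poly" assume "degree p = m" "lead_coeff p = 1"
      then obtain x where "x \<in> K" "\<not> cmod (poly p (of_real x)) < cheb1 K m + 1 / real (Suc i)"
        using no[of p] unfolding Q_def by auto
      then show "\<exists>x\<in>K. cheb1 K m + 1 / real (Suc i) \<le> cmod (poly p (of_real x))"
        by (intro bexI[of _ x]) auto
    qed
    then show False by (simp add: divide_le_0_iff)
  qed
  then obtain p where p: "\<And>i. degree (p i) = m" "\<And>i. lead_coeff (p i) = 1"
    and pb: "\<And>i x. x \<in> K \<Longrightarrow> cmod (poly (p i) (of_real x)) < cheb1 K m + 1 / real (Suc i)"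
    by metis
  obtain X0 where X0: "finite X0" "card X0 = Suc m" "X0 \<subseteq> K"
    using infinite_arbitrarily_large[OF K(2)] by blast
  define X where "X = complex_of_real ` X0"
  have X: "finite X" "card X = Suc m"
    using X0 by (auto simp: X_def card_image inj_on_def)
  have bdd: "bounded (range (\<lambda>i. poly (p i) x))" if x: "x \<in> X" for x
  proof (rule boundedI[where B = "cheb1 K m + 1"], clarify)
    fix i
    obtain y where y: "x = of_real y" "y \<in> K" using x X0 by (auto simp: X_def)
    have "1 / real (Suc i) \<le> 1" by simp
    then show "norm (poly (p i) x) \<le> cheb1 K m + 1" using pb[OF y(2), of i] unfolding y(1) by linarith
  qed
  obtain r :: "nat \<Rightarrow> nat" where r: "strict_mono r"
    and conv: "\<forall>x\<in>X. convergent ((\<lambda>i. poly (p i) x) \<circ> r)"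
    using common_convergent_subsequence[where f = "\<lambda>x i. poly (p i) x", OF X(1) bdd] by auto
  define l where "l x = lim (\<lambda>i. poly (p (r i)) x)" for x
  have l: "(\<lambda>i. poly (p (r i)) x) \<longlonglongrightarrow> l x" if "x \<in> X" for x
    using bspec[OF conv that] by (simp add: o_def convergent_LIMSEQ_iff l_def)
  define W where "W x = (\<Prod>y\<in>X - {x}. [:- y, 1:])" for x
  define q where "q = (\<Sum>x\<in>X. smult (l x / (\<Prod>y\<in>X - {x}. x - y)) (W x))"
  have pe: "p i = (\<Sum>x\<in>X. smult (poly (p i) x / (\<Prod>y\<in>X - {x}. x - y)) (W x))" for i
    unfolding W_def using X p(1)[of i] by (intro lagrange_interpolation) auto
  have lim: "(\<lambda>i. coeff (p (r i)) k) \<longlonglongrightarrow> coeff q k" for k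
  proof -
    have "(\<lambda>i. \<Sum>x\<in>X. poly (p (r i)) x / (\<Prod>y\<in>X - {x}. x - y) * coeff (W x) k) \<longlonglongrightarrow>
       (\<Sum>x\<in>X. l x / (\<Prod>y\<in>X - {x}. x - y) * coeff (W x) k)"
    proof (intro tendsto_sum tendsto_mult tendsto_divide l tendsto_const)
      show "(\<Prod>y\<in>X - {x}. x - y) \<noteq> 0" for x using X by auto
    qed
    then show ?thesis by (subst pe) (simp add: q_def coeff_sum)
  qed
  \<comment> \<open>These coefficients are constant along the sequence, so the limit is again monic
    of degree \<open>m\<close>.\<close>
  have "coeff q k = (if k = m then 1 else 0)" if "k \<ge> m" for k
  proof -
    have "coeff (p (r i)) k = (if k = m then 1 else 0)" for i
      using p[of "r i"] that by (auto simp: coeff_eq_0)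
    with lim[of k] show ?thesis by (simp add: LIMSEQ_const_iff)
  qed
  then have q: "coeff q m = 1" "\<And>k. k > m \<Longrightarrow> coeff q k = 0" by auto
  then have deg: "degree q = m" by (intro antisym degree_le le_degree) auto
  have "cmod (poly q (of_real x)) \<le> cheb1 K m" if x: "x \<in> K" for x
  proof -
    have "(\<lambda>i. \<Sum>k\<le>m. coeff (p (r i)) k * of_real x ^ k) \<longlonglongrightarrow> (\<Sum>k\<le>m. coeff q k * of_real x ^ k)"
      by (intro tendsto_intros lim)
    then have "(\<lambda>i. poly (p (r i)) (of_real x)) \<longlonglongrightarrow> poly q (of_real x)"
      using deg p(1) by (simp add: poly_altdef_le[of _ m])
    moreover have "(\<lambda>i. cheb1 K m + 1 / real (Suc (r i))) \<longlonglongrightarrow> cheb1 K m + 0"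
      using LIMSEQ_subseq_LIMSEQ[OF LIMSEQ_inverse_real_of_nat r]
      by (intro tendsto_intros) (simp add: o_def inverse_eq_divide)
    ultimately have "cmod (poly q (of_real x)) \<le> cheb1 K m + 0"
      by (intro tendsto_le[OF _ _ tendsto_norm]) (use pb[OF x] in \<open>auto intro!: always_eventually less_imp_le\<close>)
    then show ?thesis by simp
  qed
  then show ?thesis using q deg by auto
qed

text \<open>Replacing the root \<open>z\<close> by \<open>Re z\<close> brings it strictly closer to
  every real point. Compactness makes the gain in the norm strict.\<close>

lemma cheb1_less_nonreal_root:
  assumes K: "compact K" "K \<noteq> {}" and S: "lead_coeff S = 1" "poly S z = 0" "Im z \<noteq> 0"
    and B: "B > 0" "\<And>x. x \<in> K \<Longrightarrow> cmod (poly S (of_real x)) \<le> B"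
  shows "cheb1 K (degree S) < B"
proof -
  obtain q where q: "S = [:- z, 1:] * q" using S(2) by (auto simp: poly_eq_0_iff_dvd)
  have lq: "lead_coeff q = 1" using S(1) by (simp add: q lead_coeff_mult del: mult_pCons_left)
  then have q0: "q \<noteq> 0" by auto
  show ?thesis
  proof (rule cheb1_less[OF K, where p = "[:- of_real (Re z), 1:] * q"])
    show "degree ([:- of_real (Re z), 1:] * q) = degree S"
      unfolding q using q0 by (subst (1 2) degree_mult_eq) auto
    show "lead_coeff ([:- of_real (Re z), 1:] * q) = 1" by (simp add: lead_coeff_mult lq del: mult_pCons_left)
    fix x assume x: "x \<in> K"
    show "cmod (poly ([:- of_real (Re z), 1:] * q) (of_real x)) < B"
    proof (cases "poly q (of_real x) = 0")
      case False
      have "\<bar>Re (of_real x - z)\<bar> < cmod (of_real x - z)"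
        using abs_Re_le_cmod[of "of_real x - z"] Im_eq_0[of "of_real x - z"] S(3) by force
      then have "cmod (of_real x - of_real (Re z)) < cmod (of_real x - z)"
        by (simp flip: of_real_diff)
      then have "cmod (poly ([:- of_real (Re z), 1:] * q) (of_real x)) < cmod (poly S (of_real x))"
        using False by (simp add: q norm_mult del: mult_pCons_left)
      with B(2)[OF x] show ?thesis by linarith
    qed (use B in simp)
  qed
qed

text \<open>No point of \<open>K\<close> lies between the two roots, so their quadratic factor has a
  positive minimum on \<open>K\<close>. Subtracting this minimum, which moves the roots apart,
  strictly reduces the factor in modulus at every point of \<open>K\<close>.\<close>

lemma cheb1_less_two_roots_in_gap:
  assumes K: "compact K" "K \<noteq> {}"
    and S: "lead_coeff S = 1" "poly S (of_real u) = 0" "poly S (of_real v) = 0" "u \<noteq> v"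
    and gap: "\<And>x. x \<in> K \<Longrightarrow> (x - u) * (x - v) > 0"
    and B: "B > 0" "\<And>x. x \<in> K \<Longrightarrow> cmod (poly S (of_real x)) \<le> B"
  shows "cheb1 K (degree S) < B"
proof -
  obtain q1 where q1: "S = [:- of_real u, 1:] * q1" using S(2) by (auto simp: poly_eq_0_iff_dvd)
  have "poly q1 (of_real v) = 0" using S(3,4) by (simp add: q1)
  then obtain q where q2: "q1 = [:- of_real v, 1:] * q" by (auto simp: poly_eq_0_iff_dvd)
  define Q :: "complex poly" where "Q = [:- of_real u, 1:] * [:- of_real v, 1:]"
  have q: "S = Q * q" by (simp only: q1 q2 Q_def mult.assoc)
  have degQ: "degree Q = 2" and lQ: "lead_coeff Q = 1" by (simp_all add: Q_def)
  have lq: "lead_coeff q = 1" using S(1) lQ by (simp add: q lead_coeff_mult)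
  then have q0: "q \<noteq> 0" by auto
  have pQ: "poly Q (of_real x) = of_real ((x - u) * (x - v))" for x
    by (simp add: Q_def algebra_simps)
  have "continuous_on K (\<lambda>x. (x - u) * (x - v))" by (intro continuous_intros)
  from continuous_attains_inf[OF K this] obtain x1 where
    x1: "x1 \<in> K" "\<And>x. x \<in> K \<Longrightarrow> (x1 - u) * (x1 - v) \<le> (x - u) * (x - v)" by blast
  define \<epsilon> where "\<epsilon> = (x1 - u) * (x1 - v)"
  have \<epsilon>: "\<epsilon> > 0" using gap x1 by (simp add: \<epsilon>_def)
  define Q' where "Q' = Q - [:of_real \<epsilon>:]"
  have Q'_eq: "Q' = [:of_real (u * v - \<epsilon>), - of_real (u + v), 1:]"
    by (simp add: Q'_def Q_def)
  have Q': "degree Q' = 2" "lead_coeff Q' = 1" "Q' \<noteq> 0"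
    unfolding Q'_eq by (simp_all add: numeral_2_eq_2)
  show ?thesis
  proof (rule cheb1_less[OF K, where p = "Q' * q"])
    have "Q \<noteq> 0" using degQ by auto
    then show "degree (Q' * q) = degree S"
      using degree_mult_eq[OF Q'(3) q0] degree_mult_eq[OF _ q0] Q'(1) degQ by (simp add: q)
    show "lead_coeff (Q' * q) = 1" by (simp only: lead_coeff_mult lq Q'(2) mult_1)
    fix x assume x: "x \<in> K"
    show "cmod (poly (Q' * q) (of_real x)) < B"
    proof (cases "poly q (of_real x) = 0")
      case False
      have "poly Q' (of_real x) = of_real ((x - u) * (x - v) - \<epsilon>)"
        by (simp only: Q'_def poly_diff pQ) simp
      moreover have "\<bar>(x - u) * (x - v) - \<epsilon>\<bar> < \<bar>(x - u) * (x - v)\<bar>"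
        using x1(2)[OF x] gap[OF x] \<epsilon> unfolding \<epsilon>_def by linarith
      ultimately have "cmod (poly Q' (of_real x)) < cmod (poly Q (of_real x))"
        by (simp only: pQ norm_of_real)
      then have "cmod (poly (Q' * q) (of_real x)) < cmod (poly S (of_real x))"
        using False by (simp add: q norm_mult)
      with B(2)[OF x] show ?thesis by linarith
    qed (use B in simp)
  qed
qed

text \<open>The modulus at \<open>z0\<close> is the product of the distances from \<open>z0\<close>
  to the \<open>m\<close> roots, which is at least \<open>r ^ m\<close> if no root is closer than
  \<open>r\<close>.\<close>

lemma monic_poly_root_near:
  fixes p :: "complex poly"
  assumes "lead_coeff p = 1" "degree p = m" "cmod (poly p z0) < r ^ m" "r > 0"
  shows "\<exists>z. poly p z = 0 \<and> dist z0 z < r"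
proof (rule ccontr)
  assume far: "\<nexists>z. poly p z = 0 \<and> dist z0 z < r"
  have "p \<noteq> 0" using assms by auto
  then obtain A where A: "size A = degree p" "p = smult (lead_coeff p) (\<Prod>x\<in>#A. [:-x, 1:])"
    using alg_closed_imp_factorization by blast
  have p: "p = (\<Prod>x\<in>#A. [:-x, 1:])" using A(2) assms(1) by simp
  have "poly (\<Prod>x\<in>#A'. [:-x, 1:]) z = 0" if "z \<in># A'" for A' and z :: complex
    using that by (induction A') auto
  then have root: "dist z0 z \<ge> r" if "z \<in># A" for z using far p that by (metis not_le)
  have "r ^ size A' \<le> cmod (poly (\<Prod>x\<in>#A'. [:-x, 1:]) z0)" if "\<And>z. z \<in># A' \<Longrightarrow> dist z0 z \<ge> r" for A'
    using that
  proof (induction A')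
    case (add z A')
    have "r * r ^ size A' \<le> dist z0 z * cmod (poly (\<Prod>x\<in>#A'. [:-x, 1:]) z0)"
      using add assms(4) by (intro mult_mono) auto
    also have "\<dots> = cmod (poly (\<Prod>x\<in>#add_mset z A'. [:-x, 1:]) z0)"
      by (simp add: dist_norm norm_mult[symmetric] algebra_simps)
    finally show ?case by simp
  qed simp
  from this[of A] root have "r ^ m \<le> cmod (poly p z0)" using A(1) assms(2) p by simp
  with assms(3) show False by simp
qed

lemma abs_cos_diff_le: "\<bar>cos x - cos y\<bar> \<le> \<bar>x - y :: real\<bar>"
proof -
  have "norm (cos x - cos y) \<le> 1 * norm (x - y)"
    by (rule field_differentiable_bound[where S = UNIV and f' = "\<lambda>x. - sin x"])
      (auto intro!: derivative_eq_intros)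
  then show ?thesis by simp
qed

text \<open>The zeros of cos(a x) in [0, pi] have spacing pi/a, so for large \<open>a\<close> two
  neighbouring ones lie close to any given angle.\<close>

lemma two_cos_zeros_near:
  assumes "\<theta> \<in> {0..pi}" "\<delta> > 0"
  obtains a :: nat and u v :: real where "a \<ge> 1" "u \<in> {0..pi}" "v \<in> {0..pi}" "u \<noteq> v"
    "cos (a * u) = 0" "cos (a * v) = 0" "\<bar>u - \<theta>\<bar> < \<delta>" "\<bar>v - \<theta>\<bar> < \<delta>"
proof -
  obtain a0 :: nat where a0: "2 * pi / \<delta> < a0" using reals_Archimedean2 by blast
  define a where "a = a0 + 2"
  have a: "a \<ge> 2" "2 * pi / a < \<delta>"
  proof -
    have "2 * pi / \<delta> < a" using a0 by (simp add: a_def)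
    then show "2 * pi / a < \<delta>" using assms(2) by (simp add: a_def field_simps)
  qed (simp add: a_def)
  \<comment> \<open>The position of \<open>\<theta>\<close> in units of \<open>pi / a\<close>; in
    these units the zeros are the half-integers.\<close>
  define w where "w = \<theta> * a / pi"
  have w: "0 \<le> w" "w \<le> a" using assms(1) 
    using mult_right_mono[of \<theta> pi "real a"] by (auto simp: w_def divide_le_eq mult.commute)
  \<comment> \<open>The cap \<open>a - 2\<close> keeps both zeros \<open>j + 1/2\<close> and
    \<open>j + 3/2\<close> inside the range near the right end; its price is the weaker bound
    \<open>w \<le> j + 2\<close>.\<close>
  define j where "j = min (nat \<lfloor>w\<rfloor>) (a - 2)"
  have j: "j \<le> w" "w \<le> j + 2" "j + 2 \<le> a"
    using w a(1) by (auto simp: j_def min_def of_nat_diff) linarith+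
  define u where "u = (j + 1 / 2) * (pi / a)"
  define v where "v = (j + 3 / 2) * (pi / a)"
  have \<theta>: "\<theta> = w * (pi / a)" using a by (simp add: w_def)
  have pa: "pi / a > 0" using a by simp
  have near: "\<bar>e * (pi / a) - \<theta>\<bar> < \<delta>" if "\<bar>e - w\<bar> \<le> 2" for e :: real
  proof -
    have "\<bar>e * (pi / a) - \<theta>\<bar> = \<bar>e - w\<bar> * (pi / a)"
      using pa by (simp only: \<theta> left_diff_distrib[symmetric] abs_mult abs_of_pos)
    also have "\<dots> \<le> 2 * (pi / a)" using that pa by (intro mult_right_mono) auto
    finally show ?thesis using a by simp
  qed
  have range: "e * (pi / a) \<in> {0..pi}" if "0 \<le> e" "e \<le> a" for e :: real
  proof -
    have "e * (pi / a) \<le> a * (pi / a)" using that pa by (intro mult_right_mono) auto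
    then show ?thesis using that a by auto
  qed
  show ?thesis
  proof (rule that[of a u v])
    show "a \<ge> 1" using a by simp
    have "real j + 3 / 2 \<le> a" using j(3) by linarith
    then show "u \<in> {0..pi}" "v \<in> {0..pi}"
      using range[of "real j + 1 / 2"] range[of "real j + 3 / 2"] unfolding u_def v_def by simp_all
    show "u \<noteq> v" using a(1) by (simp add: u_def v_def)
    have "a * u = (2 * j + 1) * (pi / 2)" "a * v = (2 * j + 3) * (pi / 2)"
      using a by (auto simp: u_def v_def field_simps)
    moreover have "cos ((2 * j + 1) * (pi / 2)) = 0" "cos ((2 * j + 3) * (pi / 2)) = 0"
      unfolding cos_zero_iff_int
      by (rule exI[of _ "2 * int j + 1"], simp) (rule exI[of _ "2 * int j + 3"], simp)
    ultimately show "cos (a * u) = 0" "cos (a * v) = 0" by metis+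
    show "\<bar>u - \<theta>\<bar> < \<delta>" "\<bar>v - \<theta>\<bar> < \<delta>" 
      using near[of "real j + 1 / 2"] near[of "real j + 3 / 2"] j unfolding u_def v_def
      by (simp_all add: abs_le_iff)
  qed
qed

text \<open>\<open>R\<close> is the real part of an extremal polynomial divided by its norm. One
  inclusion is immediate. For the other, a missing preimage point, real or not, would allow a better
  polynomial in some degree \<open>a * m\<close> than \<open>cheb1_ge_log_cap\<close>
  permits.\<close>

lemma cheb1_eq_imp_preimage:
  assumes K: "compact K" "non_polar K" and m: "m \<ge> 1" and eq: "cheb1 K m = 2 * log_cap K ^ m"
  shows "\<exists>R :: complex poly. degree R = m \<and>
    complex_of_real ` K = {z. poly R z \<in> complex_of_real ` {-1..1}}"
proof -
  have ne: "K \<noteq> {}" using K non_polar_nonempty by blast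
  define t where "t = cheb1 K m"
  have t: "t > 0" using K by (simp add: t_def eq non_polar_def)
  obtain p where p: "degree p = m" "lead_coeff p = 1"
    and pb: "\<And>x. x \<in> K \<Longrightarrow> cmod (poly p (of_real x)) \<le> t"
    using cheb1_attained[OF K(1) non_polar_infinite[OF K], of m] by (auto simp: t_def)
  define T where "T = poly_cplx (poly_Re p)"
  have T: "degree T = m" "lead_coeff T = 1"
    using monic_poly_Re[OF p(2)] p by (auto simp: T_def)
  have TK: "\<exists>y. \<bar>y\<bar> \<le> t \<and> poly T (of_real x) = of_real y" if "x \<in> K" for x
  proof (intro exI conjI)
    show "\<bar>poly (poly_Re p) x\<bar> \<le> t"
      using pb[OF that] abs_Re_le_cmod[of "poly p (of_real x)"] unfolding poly_poly_Re by linarith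
    show "poly T (of_real x) = of_real (poly (poly_Re p) x)" by (simp add: T_def)
  qed
  define R where "R = smult (of_real (1 / t)) T"
  have R: "degree R = m" using t T by (simp add: R_def)
  have mem: "z \<in> complex_of_real ` K" if z: "poly T z = of_real y0" "\<bar>y0\<bar> \<le> t" for z y0
  proof (rule ccontr)
    assume zK: "z \<notin> complex_of_real ` K"
    have "closed (complex_of_real ` K)"
      by (intro compact_imp_closed compact_continuous_image continuous_intros K)
    then obtain r where r: "r > 0" "\<And>x. x \<in> K \<Longrightarrow> \<not> dist z (of_real x) < r"
      using zK unfolding closed_def open_dist
      by (metis ComplI ComplD dist_commute image_eqI)
    define \<theta> where "\<theta> = arccos (y0 / t)"
    have \<theta>: "\<theta> \<in> {0..pi}" "y0 = t * cos \<theta>"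
      using z t by (auto simp: \<theta>_def cos_arccos arccos_lbound arccos_ubound field_simps abs_le_iff)
    \<comment> \<open>Since the cosine is 1-Lipschitz, the tolerance \<open>r ^ m / t\<close> puts
      \<open>t * cos u\<close> and \<open>t * cos v\<close> within \<open>r ^ m\<close> of
      \<open>y0\<close>, which is what \<open>monic_poly_root_near\<close> needs to find preimages
      within \<open>r\<close> of \<open>z\<close>.\<close>
    obtain a :: nat and u v :: real where auv: "a \<ge> 1" "u \<in> {0..pi}" "v \<in> {0..pi}" "u \<noteq> v"
      "cos (a * u) = 0" "cos (a * v) = 0" "\<bar>u - \<theta>\<bar> < r ^ m / t" "\<bar>v - \<theta>\<bar> < r ^ m / t"
      using two_cos_zeros_near[OF \<theta>(1), of "r ^ m / t"] r t by auto
    have root: "\<exists>w. poly T w = of_real (t * cos e) \<and> dist z w < r" if e: "\<bar>e - \<theta>\<bar> < r ^ m / t" for e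
    proof -
      have "\<bar>t * cos e - y0\<bar> = t * \<bar>cos e - cos \<theta>\<bar>"
        using t by (simp add: \<theta>(2) abs_mult flip: right_diff_distrib)
      also have "\<dots> \<le> t * \<bar>e - \<theta>\<bar>" using t by (intro mult_left_mono abs_cos_diff_le) auto
      also have "\<dots> < t * (r ^ m / t)" using t e by (intro mult_strict_left_mono) auto
      finally have lt: "\<bar>t * cos e - y0\<bar> < r ^ m" using t by simp
      define T' where "T' = T - [:of_real (t * cos e):]"
      have T': "degree T' = m" "lead_coeff T' = 1"
      proof -
        have *: "T' = [:- of_real (t * cos e):] + T" by (simp add: T'_def)
        have lt: "degree [:- complex_of_real (t * cos e):] < degree T" using T m by simp
        show "degree T' = m" unfolding * using degree_add_eq_right[OF lt] T by simp
        show "lead_coeff T' = 1" unfolding * lead_coeff_add_le[OF lt] by (rule T)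
      qed
      have "cmod (poly T' z) = \<bar>t * cos e - y0\<bar>"
        unfolding T'_def poly_diff z(1)
        by (simp add: abs_minus_commute del: of_real_mult flip: of_real_diff)
      with lt have "cmod (poly T' z) < r ^ m" by simp
      from monic_poly_root_near[OF T'(2,1) this r(1)] show ?thesis by (auto simp: T'_def)
    qed
    obtain w1 where w1: "poly T w1 = of_real (t * cos u)" "dist z w1 < r" using root auv by blast
    obtain w2 where w2: "poly T w2 = of_real (t * cos v)" "dist z w2 < r" using root auv by blast
    have "cos u \<noteq> cos v" using auv cos_inj_pi[of u v] by auto
    then have "poly T w1 \<noteq> poly T w2" using w1(1) w2(1) t by simp
    then have w: "w1 \<noteq> w2" by auto
    define S where "S = cheb_comp T t a"
    have S: "degree S = a * m" "lead_coeff S = 1"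
      using cheb_comp_degree[OF T m auv(1)] by (auto simp: S_def)
    have S0: "poly S w1 = 0" "poly S w2 = 0"
      unfolding S_def poly_cheb_comp[OF w1(1)] poly_cheb_comp[OF w2(1)] using auv by simp_all
    define B where "B = 2 * (t / 2) ^ a"
    have B: "B > 0" using t by (simp add: B_def)
    have SB: "cmod (poly S (of_real x)) \<le> B" if "x \<in> K" for x
      using TK[OF that] t unfolding S_def B_def by (blast intro: cheb_comp_bound)
    have "cheb1 K (degree S) < B"
    \<comment> \<open>A nonreal root can be moved to the real line. If both are real, the segment
      between them lies in the ball around \<open>z\<close> that avoids \<open>K\<close>, so they
      share a gap of \<open>K\<close>.\<close>
    proof (cases "Im w1 = 0 \<and> Im w2 = 0")
      case False
      then show ?thesis using cheb1_less_nonreal_root[OF K(1) ne S(2) _ _ B SB] S0 by blast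
    next
      case True
      then have wr: "w1 = of_real (Re w1)" "w2 = of_real (Re w2)" by (simp_all add: complex_eq_iff)
      show ?thesis
      proof (rule cheb1_less_two_roots_in_gap[OF K(1) ne S(2) _ _ _ _ B SB])
        show "poly S (of_real (Re w1)) = 0" "poly S (of_real (Re w2)) = 0" using S0 wr by metis+
        show "Re w1 \<noteq> Re w2" using w wr by metis
        fix x assume x: "x \<in> K"
        show "(x - Re w1) * (x - Re w2) > 0"
        proof (rule ccontr)
          assume "\<not> ?thesis"
          then have "x \<in> closed_segment (Re w1) (Re w2)"
            by (auto simp: closed_segment_eq_real_ivl not_less mult_le_0_iff)
          then have "of_real x \<in> closed_segment w1 w2"
            using wr closed_segment_of_real[of "Re w1" "Re w2"] by (metis image_eqI)
          then have "of_real x \<in> ball z r"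
            using closed_segment_subset[OF _ _ convex_ball, of w1 z r w2] w1(2) w2(2) by auto
          then show False using r(2)[OF x] by simp
        qed
      qed
    qed
    also have "B = 2 * log_cap K ^ (a * m)"
      by (simp add: B_def t_def eq power_mult[symmetric] mult.commute)
    also have "\<dots> \<le> cheb1 K (degree S)"
      unfolding S using m auv(1) by (intro cheb1_ge_log_cap K) (simp add: Suc_le_eq)
    finally show False by simp
  qed
  have "complex_of_real ` K = {z. poly R z \<in> complex_of_real ` {-1..1}}"
  proof (intro equalityI subsetI)
    fix z assume "z \<in> complex_of_real ` K"
    then obtain x y where xy: "z = of_real x" "\<bar>y\<bar> \<le> t" "poly T z = of_real y" using TK by blast
    have "poly R z = of_real (y / t)" by (simp add: R_def xy(3))
    moreover have "y / t \<in> {-1..1}" using xy(2) t by (auto simp: field_simps abs_le_iff)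
    ultimately show "z \<in> {z. poly R z \<in> complex_of_real ` {-1..1}}" by blast
  next
    fix z assume "z \<in> {z. poly R z \<in> complex_of_real ` {-1..1}}"
    then obtain y where y: "\<bar>y\<bar> \<le> 1" "poly R z = of_real y" by (auto simp: abs_le_iff)
    then have "poly T z = of_real (t * y)" using t by (simp add: R_def field_simps)
    moreover have "\<bar>t * y\<bar> \<le> t" using y t by (simp add: abs_mult mult_left_le)
    ultimately show "z \<in> complex_of_real ` K" using mem by blast
  qed
  with R show ?thesis by blast
qed

section \<open>Polynomial preimages of the interval\<close>

text \<open>Under the Joukowski map \<^term>\<open>y = (w + 1 / w) / 2\<close> the product becomes, up to a power of
  \<^term>\<open>w\<close>, a polynomial in \<^term>\<open>w\<close> with constant term \<^term>\<open>(- 1 / 2) ^ size A\<close>.\<close>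

lemma interval_prod_lower_bound:
  fixes A :: "complex multiset"
  assumes B: "\<And>y. y \<in> {-1..1} \<Longrightarrow> cmod (\<Prod>c\<in>#A. c - of_real y) \<le> B"
  shows "(1 / 2) ^ size A \<le> B"
proof -
  define g where "g w = (\<Prod>c\<in>#A. c * w - (w\<^sup>2 + 1) / 2)" for w :: complex
  have hol: "(\<lambda>w. \<Prod>c\<in>#A. c * w - (w\<^sup>2 + 1) / 2) holomorphic_on UNIV"
    by (induction A) (auto intro!: holomorphic_intros)
  have "cmod (g 0) \<le> B"
  proof (rule maximum_modulus_frontier[of g "cball 0 1"])
    show "g holomorphic_on interior (cball 0 1)"
      using hol holomorphic_on_subset unfolding g_def by blast
    show "continuous_on (closure (cball 0 1)) g"
      using holomorphic_on_imp_continuous_on[OF hol] continuous_on_subset unfolding g_def by blast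
    fix w :: complex assume "w \<in> frontier (cball 0 1)"
    then have w: "cmod w = 1" by (simp add: frontier_cball)
    have "w * cnj w = 1" using w by (simp add: complex_norm_square[symmetric])
    then have "w\<^sup>2 + 1 = w * (w + cnj w)" by (simp add: power2_eq_square algebra_simps)
    \<comment> \<open>On the unit circle the Joukowski value is \<open>Re w\<close>, which lies in
      [-1,1], so there \<open>g\<close> has the modulus of the given product; the maximum principle
      carries the bound to the origin.\<close>
    then have eq: "c * w - (w\<^sup>2 + 1) / 2 = w * (c - of_real (Re w))" for c
      by (simp add: complex_add_cnj algebra_simps)
    have "cmod (\<Prod>c\<in>#A'. w * (c - of_real (Re w))) = cmod (\<Prod>c\<in>#A'. c - of_real (Re w))" for A'
      by (induction A') (simp_all add: norm_mult w)
    then have "cmod (g w) = cmod (\<Prod>c\<in>#A. c - of_real (Re w))" unfolding g_def eq .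
    also have "\<dots> \<le> B" using abs_Re_le_cmod[of w] w by (intro B) (auto simp: abs_le_iff)
    finally show "cmod (g w) \<le> B" .
  qed auto
  moreover have "cmod (\<Prod>c\<in>#A. c * 0 - (0\<^sup>2 + 1) / 2) = (1 / 2) ^ size A"
    by (induction A) (simp_all add: norm_mult)
  ultimately show ?thesis unfolding g_def by simp
qed

text \<open>The product of \<^term>\<open>p\<close> over the roots of \<^term>\<open>R - y\<close> is, up to a constant, the product of
  \<^term>\<open>poly R b - y\<close> over the roots \<^term>\<open>b\<close> of \<^term>\<open>p\<close>.\<close>

lemma preimage_sup_norm_lower_bound:
  fixes R p :: "complex poly"
  assumes R: "degree R = m" "m \<ge> 1" and p: "lead_coeff p = 1"
    and B: "\<And>z. poly R z \<in> complex_of_real ` {-1..1} \<Longrightarrow> cmod (poly p z) \<le> B"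
  shows "(1 / (2 * cmod (lead_coeff R))) ^ degree p \<le> B ^ m"
proof -
  define lc where "lc = lead_coeff R"
  have lc: "lc \<noteq> 0" using R by (auto simp: lc_def)
  obtain A where A: "size A = degree p" "p = (\<Prod>b\<in>#A. [:- b, 1:])"
    using alg_closed_imp_factorization[of p] p by fastforce
  have poly_mset: "poly (\<Prod>b\<in>#X. [:- b, 1:]) z = (\<Prod>b\<in>#X. z - b)" for X and z :: complex
    by (induction X) (auto simp: algebra_simps)
  have "cmod (\<Prod>c\<in>#image_mset (poly R) A. c - of_real y) \<le> cmod lc ^ degree p * B ^ m"
    if y: "y \<in> {-1..1}" for y
  proof -
    define Ry where "Ry = R - [:of_real y:]"
    have Ry: "degree Ry = m" "lead_coeff Ry = lc"
    proof -
      have *: "Ry = [:- of_real y:] + R" by (simp add: Ry_def)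
      have lt: "degree [:- complex_of_real y:] < degree R" using R by simp
      show "degree Ry = m" unfolding * using degree_add_eq_right[OF lt] R by simp
      show "lead_coeff Ry = lc" unfolding * lead_coeff_add_le[OF lt] lc_def ..
    qed
    obtain X where X: "size X = degree Ry" "Ry = smult (lead_coeff Ry) (\<Prod>x\<in>#X. [:- x, 1:])"
      using alg_closed_imp_factorization[of Ry] Ry lc by force
    have Rb: "poly R z - of_real y = lc * (\<Prod>x\<in>#X. z - x)" for z
    proof -
      have "poly R z - of_real y = poly Ry z" by (simp add: Ry_def)
      also have "\<dots> = lc * (\<Prod>x\<in>#X. z - x)" by (subst X(2)) (simp add: Ry(2) poly_mset)
      finally show ?thesis .
    qed
    have root: "cmod (poly p x) \<le> B" if "x \<in># X" for x
    proof -
      have "(\<Prod>x'\<in>#X'. x - x') = 0" if "x \<in># X'" for X' using that by (induction X') auto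
      then have "poly R x - of_real y = 0" using that by (simp add: Rb)
      then show ?thesis using y by (intro B) auto
    qed
    \<comment> \<open>Both sides are the modulus of the resultant of \<open>p\<close> and
      \<open>Ry\<close>, up to powers of the leading coefficient, computed over the roots of the one
      or of the other.\<close>
    have swap: "cmod (\<Prod>b\<in>#A'. lc * (\<Prod>x\<in>#X. b - x)) =
        cmod lc ^ size A' * (\<Prod>x\<in>#X. cmod (\<Prod>b\<in>#A'. x - b))" for A'
    proof (induction A')
      case (add b A')
      have "cmod (\<Prod>x\<in>#X'. b - x) * (\<Prod>x\<in>#X'. cmod (\<Prod>b\<in>#A'. x - b)) =
          (\<Prod>x\<in>#X'. cmod (\<Prod>b\<in>#add_mset b A'. x - b))" for X'
        by (induction X') (simp_all add: norm_mult norm_minus_commute)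
      with add show ?case by (simp add: norm_mult algebra_simps)
    qed simp
    have "(\<Prod>x\<in>#X'. cmod (poly p x)) \<le> B ^ size X'" if "\<And>x. x \<in># X' \<Longrightarrow> cmod (poly p x) \<le> B" for X'
      using that
    proof (induction X')
      case (add x X')
      have "0 \<le> (\<Prod>x\<in>#X'. cmod (poly p x))" by (induction X') auto
      moreover have "0 \<le> B" using add.prems[of x] norm_ge_zero order_trans by (metis union_single_eq_member)
      ultimately show ?case using add by (auto intro!: mult_mono)
    qed simp
    from this[of X] root have "(\<Prod>x\<in>#X. cmod (poly p x)) \<le> B ^ m" using X(1) Ry(1) by simp
    then have "cmod lc ^ degree p * (\<Prod>x\<in>#X. cmod (poly p x)) \<le> cmod lc ^ degree p * B ^ m"
      by (intro mult_left_mono) auto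
    moreover have "cmod (\<Prod>c\<in>#image_mset (poly R) A. c - of_real y) =
        cmod lc ^ degree p * (\<Prod>x\<in>#X. cmod (poly p x))"
      using swap[of A] by (simp add: Rb A(1) image_mset.compositionality o_def A(2)[symmetric] flip: poly_mset)
    ultimately show ?thesis by simp
  qed
  from interval_prod_lower_bound[OF this]
  have "(1 / 2) ^ degree p \<le> cmod lc ^ degree p * B ^ m" by (simp add: A(1))
  then show ?thesis using lc by (simp add: lc_def field_simps power_mult_distrib)
qed

text \<open>With \<open>s ^ m = 1 / (2 * cmod lc)\<close>, the product over fibres gives
  \<open>s ^ k \<le> cheb1 K k\<close> for every \<open>k\<close>, hence
  \<open>s \<le> log_cap K\<close>. The monic multiple of \<open>R\<close> has norm at most
  \<open>2 * s ^ m\<close>, which yields the upper bound.\<close>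

lemma preimage_imp_cheb1_eq:
  fixes R :: "complex poly"
  assumes K: "compact K" "non_polar K" and R: "degree R = m" "m \<ge> 1"
    and pre: "complex_of_real ` K = {z. poly R z \<in> complex_of_real ` {-1..1}}"
  shows "cheb1 K m = 2 * log_cap K ^ m"
proof (rule antisym)
  have ne: "K \<noteq> {}" using K non_polar_nonempty by blast
  define lc where "lc = lead_coeff R"
  have lc: "lc \<noteq> 0" using R by (auto simp: lc_def)
  define s where "s = root m (1 / (2 * cmod lc))"
  have s: "s > 0" "s ^ m = 1 / (2 * cmod lc)" using lc R by (auto simp: s_def)
  have "s \<le> log_cap K"
  proof (rule log_cap_ge[OF K, of 1])
    fix k
    show "1 * s ^ k \<le> cheb1 K k"
    proof (rule cheb1_geI[OF K(1)])
      fix p :: "complex poly" assume p: "degree p = k" "lead_coeff p = 1"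
      obtain x0 where x0: "x0 \<in> K" "\<And>y. y \<in> K \<Longrightarrow> cmod (poly p (of_real y)) \<le> cmod (poly p (of_real x0))"
        using continuous_attains_sup[OF K(1) ne continuous_on_cmod_poly] by blast
      have "cmod (poly p z) \<le> cmod (poly p (of_real x0))" if "poly R z \<in> complex_of_real ` {-1..1}" for z
      proof -
        have "z \<in> complex_of_real ` K" using that pre by simp
        then show ?thesis using x0(2) by auto
      qed
      from preimage_sup_norm_lower_bound[OF R p(2) this]
      have "(s ^ k) ^ m \<le> cmod (poly p (of_real x0)) ^ m"
        using s(2) by (simp only: p(1) lc_def[symmetric] power_mult[symmetric] mult.commute[of k]) (simp only: power_mult)
      then have "s ^ k \<le> cmod (poly p (of_real x0))"
        using R(2) s(1) by (subst (asm) power_mono_iff) auto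
      then show "\<exists>x\<in>K. 1 * s ^ k \<le> cmod (poly p (of_real x))" using x0(1) by auto
    qed
  qed (use s in auto)
  then have "2 * s ^ m \<le> 2 * log_cap K ^ m" using s(1) by (simp add: power_mono)
  moreover have "cheb1 K m \<le> 2 * s ^ m"
  proof (rule cheb1_le[OF K(1) ne, where p = "smult (1 / lc) R"])
    fix x assume "x \<in> K"
    then have "poly R (of_real x) \<in> complex_of_real ` {-1..1}" using pre by blast
    then have "cmod (poly R (of_real x)) \<le> 1" by auto
    then show "cmod (poly (smult (1 / lc) R) (of_real x)) \<le> 2 * s ^ m"
      unfolding s(2) by (simp add: norm_mult norm_divide divide_right_mono)
  qed (use lc R in \<open>simp_all add: lc_def\<close>)
  ultimately show "cheb1 K m \<le> 2 * log_cap K ^ m" by linarith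
qed (rule cheb1_ge_log_cap[OF K R(2)])

section \<open>Chebyshev numbers of product sets\<close>

text \<open>This is the Hahn-Banach extension, one degree at a time, of the functional that reads off the
  coefficient of degree \<^term>\<open>m\<close>; it replaces an extremal signed measure.\<close>

lemma coeff_functional_extension:
  fixes K :: "real set"
  assumes K: "compact K" "K \<noteq> {}" and t: "t > 0"
    and lower: "\<And>p :: real poly. degree p = m \<Longrightarrow> lead_coeff p = 1 \<Longrightarrow> \<exists>x\<in>K. t \<le> \<bar>poly p x\<bar>"
  shows "m \<le> D \<Longrightarrow> \<exists>a :: nat \<Rightarrow> real. a m = 1 \<and> (\<forall>d<m. a d = 0) \<and>
    (\<forall>p B. degree p \<le> D \<longrightarrow> (\<forall>x\<in>K. \<bar>poly p x\<bar> \<le> B) \<longrightarrow> t * \<bar>\<Sum>d\<le>D. a d * coeff p d\<bar> \<le> B)"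
proof (induction D rule: dec_induct)
  case base
  define a :: "nat \<Rightarrow> real" where "a d = (if d = m then 1 else 0)" for d
  have "t * \<bar>\<Sum>d\<le>m. a d * coeff p d\<bar> \<le> B"
    if p: "degree p \<le> m" "\<forall>x\<in>K. \<bar>poly p x\<bar> \<le> B" for p B
  proof -
    have eq: "(\<Sum>d\<le>m. a d * coeff p d) = coeff p m"
      by (simp add: a_def if_distrib[of "\<lambda>x. x * _"] cong: if_cong)
    show ?thesis
    proof (cases "coeff p m = 0")
      case True
      obtain x where "x \<in> K" using K by auto
      then have "0 \<le> B" using p(2) abs_ge_zero order_trans by blast
      then show ?thesis using True eq by simp
    next
      case False
      then have deg: "degree p = m" using p(1) by (intro antisym le_degree)
      have "degree (smult (1 / coeff p m) p) = m" using False deg by simp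
      moreover have "lead_coeff (smult (1 / coeff p m) p) = 1" using False deg by simp
      ultimately obtain x where x: "x \<in> K" "t \<le> \<bar>poly (smult (1 / coeff p m) p) x\<bar>"
        using lower by blast
      then have "t * \<bar>coeff p m\<bar> \<le> \<bar>poly p x\<bar>" using False by (simp add: abs_mult field_simps)
      then show ?thesis using p(2) x(1) eq by force
    qed
  qed
  then show ?case by (intro exI[of _ a]) (auto simp: a_def)
next
  case (step D)
  then obtain a where a: "a m = 1" "\<And>d. d < m \<Longrightarrow> a d = 0"
    and bound: "\<And>p B. degree p \<le> D \<Longrightarrow> \<forall>x\<in>K. \<bar>poly p x\<bar> \<le> B \<Longrightarrow> t * \<bar>\<Sum>d\<le>D. a d * coeff p d\<bar> \<le> B"
    by blast
  define L where "L p = (\<Sum>d\<le>D. a d * coeff p d)" for p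
  define X where "X = monom (1::real) (Suc D)"
  define N where "N p = (SUP x\<in>K. \<bar>poly p x\<bar>)" for p
  have N: "\<bar>poly p x\<bar> \<le> N p" if "x \<in> K" for p x
    unfolding N_def using that
    by (intro cSUP_upper bounded_imp_bdd_above compact_imp_bounded compact_continuous_image
        continuous_intros K)
  have Nle: "N p \<le> B" if "\<forall>x\<in>K. \<bar>poly p x\<bar> \<le> B" for p B
    unfolding N_def using that K by (intro cSUP_least) auto
  \<comment> \<open>The value of the extended functional on the new monomial \<open>X\<close>. It
    must lie between the two sides of \<open>sep\<close> for all \<open>p\<close> and
    \<open>q\<close>; the infimum of the upper sides does.\<close>
  define v where "v = (INF p\<in>{p. degree p \<le> D}. N (p + X) / t - L p)"
  have sep: "- (N (q + X) / t) - L q \<le> N (p + X) / t - L p"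
    if "degree p \<le> D" "degree q \<le> D" for p q
  proof -
    \<comment> \<open>The monomial \<open>X\<close> cancels in the difference of
      \<open>p + X\<close> and \<open>q + X\<close>, so the bound in degree \<open>D\<close>
      applies.\<close>
    have "t * \<bar>L (p - q)\<bar> \<le> N (p + X) + N (q + X)"
      unfolding L_def
    proof (rule bound[OF degree_diff_le[OF that]], rule ballI)
      fix x assume x: "x \<in> K"
      show "\<bar>poly (p - q) x\<bar> \<le> N (p + X) + N (q + X)"
        using N[OF x, of "p + X"] N[OF x, of "q + X"] by simp
    qed
    then have "\<bar>L (p - q)\<bar> \<le> (N (p + X) + N (q + X)) / t" using t by (simp add: field_simps)
    moreover have "L (p - q) = L p - L q" by (simp add: L_def sum_subtractf algebra_simps)
    ultimately show ?thesis by (simp add: add_divide_distrib abs_le_iff)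
  qed
  have ne: "{p :: real poly. degree p \<le> D} \<noteq> {}" by (auto intro: exI[of _ 0])
  have bdd: "bdd_below ((\<lambda>p. N (p + X) / t - L p) ` {p. degree p \<le> D})"
    using sep[of _ 0] by (intro bdd_belowI2[of _ "- (N (0 + X) / t) - L 0"]) auto
  have v1: "v \<le> N (p + X) / t - L p" if "degree p \<le> D" for p
    unfolding v_def using that by (intro cINF_lower bdd) auto
  have v2: "- (N (p + X) / t) - L p \<le> v" if "degree p \<le> D" for p
    unfolding v_def using that sep by (intro cINF_greatest ne) auto
  have v: "t * \<bar>L p + v\<bar> \<le> N (p + X)" if "degree p \<le> D" for p
  proof -
    have "\<bar>L p + v\<bar> \<le> N (p + X) / t" using v1[OF that] v2[OF that] by linarith
    then show ?thesis using t by (simp add: field_simps)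
  qed
  define b where "b = a(Suc D := v)"
  have "t * \<bar>\<Sum>d\<le>Suc D. b d * coeff p d\<bar> \<le> B"
    if p: "degree p \<le> Suc D" "\<forall>x\<in>K. \<bar>poly p x\<bar> \<le> B" for p B
  proof -
    define c where "c = coeff p (Suc D)"
    have "(\<Sum>d\<le>D. b d * coeff p d) = L p"
      unfolding L_def by (intro sum.cong) (auto simp: b_def)
    then have eq: "(\<Sum>d\<le>Suc D. b d * coeff p d) = L p + v * c" by (simp add: b_def c_def)
    show ?thesis
    proof (cases "c = 0")
      case True
      then have "degree p \<le> D" using p(1) unfolding c_def
        by (metis le_SucE leading_coeff_0_iff degree_0 le0)
      then show ?thesis using bound[OF _ p(2)] True unfolding eq by (simp add: L_def)
    next
      case False
      \<comment> \<open>By homogeneity it suffices to treat top coefficient 1, that is, the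
        polynomials \<open>q + X\<close> covered by \<open>v\<close>.\<close>
      define q where "q = smult (1 / c) p - X"
      have "coeff q d = 0" if "d > D" for d
        using that p(1) False unfolding q_def X_def c_def
        by (cases "d = Suc D") (auto simp: coeff_eq_0)
      then have q: "degree q \<le> D" by (intro degree_le) auto
      have "coeff q d = coeff p d / c" if "d \<le> D" for d
        using that by (simp add: q_def X_def)
      then have "L q = L p / c" by (simp add: L_def sum_divide_distrib)
      then have "t * \<bar>L p + v * c\<bar> = \<bar>c\<bar> * (t * \<bar>L q + v\<bar>)"
        using False by (simp add: abs_mult[symmetric] field_simps)
      also have "\<dots> \<le> \<bar>c\<bar> * N (q + X)" by (intro mult_left_mono v q) auto
      also have "N (q + X) \<le> B / \<bar>c\<bar>"
        using p(2) False by (intro Nle) (auto simp: q_def divide_right_mono)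
      then have "\<bar>c\<bar> * N (q + X) \<le> B" using False by (simp add: field_simps)
      finally show ?thesis unfolding eq .
    qed
  qed
  moreover have "b m = 1" "\<forall>d<m. b d = 0" using a step.hyps by (auto simp: b_def)
  ultimately show ?case by blast
qed

text \<open>The functionals are applied one variable at a time, with the later variables frozen at
  points of their sets; each application costs a factor \<open>t j\<close>.\<close>

lemma product_functional_bound:
  fixes Ks :: "nat \<Rightarrow> real set" and a :: "nat \<Rightarrow> nat \<Rightarrow> real" and c :: "(nat \<Rightarrow> nat) \<Rightarrow> real"
  assumes ne: "\<And>j. j < n \<Longrightarrow> Ks j \<noteq> {}" and t: "\<And>j. j < n \<Longrightarrow> t j > 0"
    and S: "finite S" "\<And>\<beta> j. \<beta> \<in> S \<Longrightarrow> j < n \<Longrightarrow> \<beta> j \<le> D"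
    and a: "\<And>j p B. j < n \<Longrightarrow> degree p \<le> D \<Longrightarrow> \<forall>x\<in>Ks j. \<bar>poly p x\<bar> \<le> B \<Longrightarrow>
      t j * \<bar>\<Sum>d\<le>D. a j d * coeff p d\<bar> \<le> B"
    and M: "\<And>x. (\<And>j. j < n \<Longrightarrow> x j \<in> Ks j) \<Longrightarrow> \<bar>\<Sum>\<beta>\<in>S. c \<beta> * (\<Prod>j<n. x j ^ \<beta> j)\<bar> \<le> M"
  shows "(\<Prod>j<n. t j) * \<bar>\<Sum>\<beta>\<in>S. c \<beta> * (\<Prod>j<n. a j (\<beta> j))\<bar> \<le> M"
proof -
  have "(\<Prod>j<r. t j) * \<bar>\<Sum>\<beta>\<in>S. c \<beta> * (\<Prod>j<r. a j (\<beta> j)) * (\<Prod>j=r..<n. x j ^ \<beta> j)\<bar> \<le> M"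
    if "r \<le> n" "\<And>j. j < n \<Longrightarrow> x j \<in> Ks j" for r x
    using that
  proof (induction r arbitrary: x)
    case 0
    then show ?case using M[of x] by (simp add: atLeast0LessThan)
  next
    case (Suc r)
    define w where "w \<beta> = c \<beta> * (\<Prod>j<r. a j (\<beta> j)) * (\<Prod>j=Suc r..<n. x j ^ \<beta> j)" for \<beta>
    \<comment> \<open>The polynomial in variable \<open>r\<close> alone: earlier variables are
      already replaced by functional values, later ones are frozen at \<open>x\<close>.\<close>
    define p where "p = (\<Sum>\<beta>\<in>S. monom (w \<beta>) (\<beta> r))"
    have T: "(\<Prod>j<r. t j) > 0" using t Suc.prems by (intro prod_pos) auto
    have "\<forall>y\<in>Ks r. \<bar>poly p y\<bar> \<le> M / (\<Prod>j<r. t j)"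
    proof
      fix y assume y: "y \<in> Ks r"
      have "w \<beta> * y ^ \<beta> r = c \<beta> * (\<Prod>j<r. a j (\<beta> j)) * (\<Prod>j=r..<n. (x(r := y)) j ^ \<beta> j)" for \<beta>
      proof -
        have "(\<Prod>j=r..<n. (x(r := y)) j ^ \<beta> j) = y ^ \<beta> r * (\<Prod>j=Suc r..<n. x j ^ \<beta> j)"
          using Suc.prems by (simp add: prod.atLeast_Suc_lessThan)
        then show ?thesis by (simp add: w_def)
      qed
      then have "poly p y = (\<Sum>\<beta>\<in>S. c \<beta> * (\<Prod>j<r. a j (\<beta> j)) * (\<Prod>j=r..<n. (x(r := y)) j ^ \<beta> j))"
        by (simp add: p_def poly_sum poly_monom)
      moreover have "(\<Prod>j<r. t j) * \<bar>\<Sum>\<beta>\<in>S. c \<beta> * (\<Prod>j<r. a j (\<beta> j)) * (\<Prod>j=r..<n. (x(r := y)) j ^ \<beta> j)\<bar> \<le> M"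
        using Suc.prems y by (intro Suc.IH) auto
      ultimately show "\<bar>poly p y\<bar> \<le> M / (\<Prod>j<r. t j)" using T by (simp add: field_simps)
    qed
    moreover have "degree p \<le> D"
      unfolding p_def using S Suc.prems
      by (intro degree_sum_le) (auto intro: order_trans[OF degree_monom_le])
    ultimately have "t r * \<bar>\<Sum>d\<le>D. a r d * coeff p d\<bar> \<le> M / (\<Prod>j<r. t j)"
      using a[of r] Suc.prems by simp
    moreover have "(\<Sum>d\<le>D. a r d * coeff p d) = (\<Sum>\<beta>\<in>S. w \<beta> * a r (\<beta> r))"
    proof -
      have "(\<Sum>d\<le>D. a r d * coeff p d) = (\<Sum>\<beta>\<in>S. \<Sum>d\<le>D. a r d * coeff (monom (w \<beta>) (\<beta> r)) d)"
        unfolding p_def coeff_sum sum_distrib_left by (rule sum.swap)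
      also have "\<dots> = (\<Sum>\<beta>\<in>S. w \<beta> * a r (\<beta> r))"
        using S(2)[of _ r] Suc.prems by (intro sum.cong) (auto simp: if_distrib cong: if_cong)
      finally show ?thesis .
    qed
    ultimately have "(\<Prod>j<r. t j) * t r * \<bar>\<Sum>\<beta>\<in>S. w \<beta> * a r (\<beta> r)\<bar> \<le> M"
      using T by (simp add: field_simps)
    then show ?case by (simp add: w_def mult_ac)
  qed
  note step = this
  define x where "x j = (SOME y. y \<in> Ks j)" for j
  have "x j \<in> Ks j" if "j < n" for j
    unfolding x_def using ne[OF that] by (simp add: some_in_eq)
  then show ?thesis using step[of n x] by simp
qed

section \<open>Predecessors of a multi-index\<close>

lemma finite_multi_idx_bounded: "finite {\<beta> \<in> multi_idx n. \<forall>j<n. \<beta> j \<le> N}"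
  by (rule finite_subset[OF _ finite_set_of_finite_funs[of "{..<n}" "{..N}" 0]])
    (auto simp: multi_idx_def not_less)

lemma le_mdeg: "j < n \<Longrightarrow> \<beta> j \<le> mdeg n \<beta>"
  unfolding mdeg_def by (intro member_le_sum) auto

text \<open>For the last conclusion: if no coordinate decreased, the degrees would have to agree,
  while the lexicographic witness makes one coordinate strictly larger. This is the fact that lets
  the product functional kill all lower terms.\<close>

lemma beforeD:
  assumes "before n \<beta> \<alpha>"
  shows "\<beta> \<in> multi_idx n" "mdeg n \<beta> \<le> mdeg n \<alpha>" "\<exists>j<n. \<beta> j < \<alpha> j"
proof -
  show "\<beta> \<in> multi_idx n" "mdeg n \<beta> \<le> mdeg n \<alpha>" using assms by (auto simp: before_def)
  show "\<exists>j<n. \<beta> j < \<alpha> j"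
  proof (rule ccontr)
    assume "\<not> ?thesis"
    then have ge: "\<alpha> j \<le> \<beta> j" if "j < n" for j using that by (meson not_le)
    then have "mdeg n \<alpha> \<le> mdeg n \<beta>" unfolding mdeg_def by (intro sum_mono) auto
    then have eq: "mdeg n \<beta> = mdeg n \<alpha>" and "lex_prec n \<beta> \<alpha>" using assms by (auto simp: before_def)
    then obtain l where "l < n" "\<alpha> l < \<beta> l" by (auto simp: lex_prec_def)
    then have "mdeg n \<alpha> < mdeg n \<beta>"
      unfolding mdeg_def using ge by (intro sum_strict_mono_ex1) auto
    with eq show False by simp
  qed
qed

lemma not_before_self: "\<not> before n \<alpha> \<alpha>"
  using beforeD(3) by blast

lemma finite_before: "finite {\<beta>. before n \<beta> \<alpha>}"
  by (rule finite_subset[OF _ finite_multi_idx_bounded[of n "mdeg n \<alpha>"]])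
    (use beforeD(1,2) le_mdeg order_trans in blast)

locale non_polar_product =
  fixes n :: nat and Ks :: "nat \<Rightarrow> real set"
  assumes n: "n \<ge> 1" and K: "\<And>j. j < n \<Longrightarrow> compact (Ks j)" and np: "\<And>j. j < n \<Longrightarrow> non_polar (Ks j)"
begin

lemma cheb1_pos: "j < n \<Longrightarrow> cheb1 (Ks j) k > 0"
proof (cases "k = 0")
  case False
  assume j: "j < n"
  then have "0 < 2 * log_cap (Ks j) ^ k" using np by (simp add: non_polar_def)
  also have "\<dots> \<le> cheb1 (Ks j) k" using False by (intro cheb1_ge_log_cap K np j) auto
  finally show ?thesis .
qed (simp add: cheb1_0 K np non_polar_nonempty)

lemma bdd_above_P_poly: "bdd_above ((\<lambda>z. cmod (P_poly n \<alpha> c z)) ` prod_set n Ks)"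
proof -
  have "\<exists>B. \<forall>x\<in>Ks j. \<bar>x\<bar> \<le> B" if "j < n" for j
    using compact_imp_bounded[OF K[OF that]] by (auto simp: bounded_iff)
  then obtain B where B: "\<And>j x. j < n \<Longrightarrow> x \<in> Ks j \<Longrightarrow> \<bar>x\<bar> \<le> B j" by metis
  have mono: "cmod (monomial n \<beta> z) \<le> (\<Prod>j<n. B j ^ \<beta> j)" if z: "z \<in> prod_set n Ks" for \<beta> z
    unfolding monomial_def
  proof -
    have "(\<Prod>j<n. cmod (z j ^ \<beta> j)) \<le> (\<Prod>j<n. B j ^ \<beta> j)"
    proof (rule prod_mono)
      fix j assume "j \<in> {..<n}"
      then have "cmod (z j) \<le> B j" using z B by (auto simp: prod_set_def)
      then show "0 \<le> cmod (z j ^ \<beta> j) \<and> cmod (z j ^ \<beta> j) \<le> B j ^ \<beta> j"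
        by (simp add: norm_power power_mono)
    qed
    then show "cmod (\<Prod>j<n. z j ^ \<beta> j) \<le> (\<Prod>j<n. B j ^ \<beta> j)" by (simp add: prod_norm)
  qed
  show ?thesis
  proof (rule bdd_aboveI2)
    fix z assume z: "z \<in> prod_set n Ks"
    have "cmod (P_poly n \<alpha> c z) \<le> cmod (monomial n \<alpha> z) + (\<Sum>\<beta>\<in>{\<beta>. before n \<beta> \<alpha>}. cmod (c \<beta> * monomial n \<beta> z))"
      unfolding P_poly_def by (intro norm_triangle_mono norm_sum order_refl)
    also have "\<dots> \<le> (\<Prod>j<n. B j ^ \<alpha> j) + (\<Sum>\<beta>\<in>{\<beta>. before n \<beta> \<alpha>}. cmod (c \<beta>) * (\<Prod>j<n. B j ^ \<beta> j))"
      using mono[OF z] by (intro add_mono sum_mono) (auto simp: norm_mult intro!: mult_left_mono)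
    finally show "cmod (P_poly n \<alpha> c z) \<le> \<dots>" .
  qed
qed

lemma prod_set_nonempty: "prod_set n Ks \<noteq> {}"
proof -
  define x where "x j = (SOME y. y \<in> Ks j)" for j
  have "x j \<in> Ks j" if "j < n" for j
    unfolding x_def using non_polar_nonempty[OF np[OF that]] by (simp add: some_in_eq)
  then have "(\<lambda>j. of_real (x j)) \<in> prod_set n Ks" by (auto simp: prod_set_def)
  then show ?thesis by blast
qed

lemma sup_norm_upper:
  "z \<in> prod_set n Ks \<Longrightarrow> cmod (P_poly n \<alpha> c z) \<le> sup_norm (prod_set n Ks) (P_poly n \<alpha> c)"
  unfolding sup_norm_def by (intro cSUP_upper bdd_above_P_poly)

text \<open>The product of the coefficient functionals is 1 on the leading monomial and 0 on every
  earlier one, so applied to any competitor it returns 1.\<close>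

lemma prod_cheb1_le_sup_norm:
  "(\<Prod>j<n. cheb1 (Ks j) (\<alpha> j)) \<le> sup_norm (prod_set n Ks) (P_poly n \<alpha> c)"
proof -
  define D where "D = mdeg n \<alpha>"
  define t where "t j = cheb1 (Ks j) (\<alpha> j)" for j
  have ne: "Ks j \<noteq> {}" if "j < n" for j using np[OF that] non_polar_nonempty by blast
  have "\<exists>a. a (\<alpha> j) = 1 \<and> (\<forall>d<\<alpha> j. a d = 0) \<and> (\<forall>p B. degree p \<le> D \<longrightarrow>
     (\<forall>x\<in>Ks j. \<bar>poly p x\<bar> \<le> B) \<longrightarrow> t j * \<bar>\<Sum>d\<le>D. a d * coeff p d\<bar> \<le> B)" if j: "j < n" for j
  proof (rule coeff_functional_extension[OF K[OF j] ne[OF j]])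
    show "t j > 0" using cheb1_pos[OF j] by (simp add: t_def)
    show "\<alpha> j \<le> D" using le_mdeg[OF j] by (simp add: D_def)
    fix p :: "real poly" assume "degree p = \<alpha> j" "lead_coeff p = 1"
    then obtain x where "x \<in> Ks j" "t j \<le> cmod (poly (poly_cplx p) (of_real x))"
      using cheb1_ex_point[OF K[OF j] ne[OF j], of "poly_cplx p" "\<alpha> j"] by (auto simp: t_def)
    then show "\<exists>x\<in>Ks j. t j \<le> \<bar>poly p x\<bar>" by (intro bexI[of _ x]) auto
  qed
  then obtain a where a1: "\<And>j. j < n \<Longrightarrow> a j (\<alpha> j) = 1" and a0: "\<And>j d. j < n \<Longrightarrow> d < \<alpha> j \<Longrightarrow> a j d = 0"
    and a: "\<And>j p B. j < n \<Longrightarrow> degree p \<le> D \<Longrightarrow> \<forall>x\<in>Ks j. \<bar>poly p x\<bar> \<le> B \<Longrightarrow>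
      t j * \<bar>\<Sum>d\<le>D. a j d * coeff p d\<bar> \<le> B"
    by metis
  define S where "S = {\<beta>. before n \<beta> \<alpha>}"
  \<comment> \<open>At real points the real part of the competitor has these real coefficients, and
    its modulus is no larger.\<close>
  define c' where "c' = (\<lambda>\<beta>. Re (c \<beta>))(\<alpha> := 1)"
  have S: "finite S" "\<alpha> \<notin> S" using finite_before not_before_self by (auto simp: S_def)
  have zero: "(\<Prod>j<n. a j (\<beta> j)) = 0" if \<beta>: "\<beta> \<in> S" for \<beta>
  proof -
    obtain j where "j < n" "\<beta> j < \<alpha> j" using \<beta> beforeD(3)[of n \<beta> \<alpha>] by (auto simp: S_def)
    then show ?thesis using a0 by (intro prod_zero) auto
  qed
  have "(\<Prod>j<n. t j) * \<bar>\<Sum>\<beta>\<in>insert \<alpha> S. c' \<beta> * (\<Prod>j<n. a j (\<beta> j))\<bar> \<le>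
      sup_norm (prod_set n Ks) (P_poly n \<alpha> c)"
  proof (rule product_functional_bound[OF ne _ _ _ a])
    show "t j > 0" if "j < n" for j using cheb1_pos[OF that] by (simp add: t_def)
    show "finite (insert \<alpha> S)" using S by simp
    show "\<beta> j \<le> D" if "\<beta> \<in> insert \<alpha> S" "j < n" for \<beta> j
      using that le_mdeg[of j n \<beta>] beforeD(2)[of n \<beta> \<alpha>] by (auto simp: S_def D_def)
    fix x :: "nat \<Rightarrow> real" assume x: "\<And>j. j < n \<Longrightarrow> x j \<in> Ks j"
    define z where "z j = complex_of_real (x j)" for j
    have z: "z \<in> prod_set n Ks" using x by (auto simp: prod_set_def z_def)
    have "monomial n \<beta> z = of_real (\<Prod>j<n. x j ^ \<beta> j)" for \<beta>
      by (simp add: monomial_def z_def)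
    then have "Re (P_poly n \<alpha> c z) = (\<Prod>j<n. x j ^ \<alpha> j) + (\<Sum>\<beta>\<in>S. Re (c \<beta>) * (\<Prod>j<n. x j ^ \<beta> j))"
      by (simp add: P_poly_def S_def del: of_real_prod of_real_power)
    also have "(\<Sum>\<beta>\<in>S. Re (c \<beta>) * (\<Prod>j<n. x j ^ \<beta> j)) = (\<Sum>\<beta>\<in>S. c' \<beta> * (\<Prod>j<n. x j ^ \<beta> j))"
      using S(2) by (intro sum.cong) (auto simp: c'_def)
    also have "(\<Prod>j<n. x j ^ \<alpha> j) + \<dots> = (\<Sum>\<beta>\<in>insert \<alpha> S. c' \<beta> * (\<Prod>j<n. x j ^ \<beta> j))"
      using S by (simp add: c'_def)
    finally have "\<bar>\<Sum>\<beta>\<in>insert \<alpha> S. c' \<beta> * (\<Prod>j<n. x j ^ \<beta> j)\<bar> \<le> cmod (P_poly n \<alpha> c z)"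
      using abs_Re_le_cmod by metis
    also have "\<dots> \<le> sup_norm (prod_set n Ks) (P_poly n \<alpha> c)" by (rule sup_norm_upper[OF z])
    finally show "\<bar>\<Sum>\<beta>\<in>insert \<alpha> S. c' \<beta> * (\<Prod>j<n. x j ^ \<beta> j)\<bar> \<le> \<dots>" .
  qed
  moreover have "(\<Sum>\<beta>\<in>insert \<alpha> S. c' \<beta> * (\<Prod>j<n. a j (\<beta> j))) = 1"
  proof -
    have "(\<Sum>\<beta>\<in>S. c' \<beta> * (\<Prod>j<n. a j (\<beta> j))) = 0"
      by (rule sum.neutral) (auto simp only: zero mult_zero_right)
    then show ?thesis using S a1 by (simp add: c'_def)
  qed
  ultimately show ?thesis by (simp add: t_def)
qed

text \<open>All other monomials in the expanded product have exponents at most those of \<alpha>,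
  hence smaller total degree, so the product is an admissible competitor.\<close>

lemma P_poly_of_product:
  fixes p :: "nat \<Rightarrow> complex poly"
  assumes \<alpha>: "\<alpha> \<in> multi_idx n" and p: "\<And>j. j < n \<Longrightarrow> degree (p j) = \<alpha> j" "\<And>j. j < n \<Longrightarrow> lead_coeff (p j) = 1"
  shows "P_poly n \<alpha> (\<lambda>\<beta>. \<Prod>j<n. coeff (p j) (\<beta> j)) z = (\<Prod>j<n. poly (p j) (z j))"
proof -
  define c where "c \<beta> = (\<Prod>j<n. coeff (p j) (\<beta> j))" for \<beta>
  define M where "M = {\<beta> \<in> multi_idx n. \<forall>j<n. \<beta> j \<le> \<alpha> j}"
  have \<alpha>M: "\<alpha> \<in> M" using \<alpha> by (simp add: M_def)
  have c\<alpha>: "c \<alpha> = 1" using p by (simp add: c_def)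
  have finM: "finite M"
    by (rule finite_subset[OF _ finite_multi_idx_bounded[of n "mdeg n \<alpha>"]])
      (use le_mdeg order_trans in \<open>fastforce simp: M_def\<close>)
  have "(\<Prod>j<n. poly (p j) (z j)) = (\<Prod>j<n. \<Sum>d\<le>\<alpha> j. coeff (p j) d * z j ^ d)"
    using p by (intro prod.cong) (auto simp: poly_altdef)
  also have "\<dots> = (\<Sum>f\<in>PiE {..<n} (\<lambda>j. {..\<alpha> j}). \<Prod>j<n. coeff (p j) (f j) * z j ^ f j)"
    by (rule prod_sum_PiE) auto
  also have "\<dots> = (\<Sum>\<beta>\<in>M. c \<beta> * monomial n \<beta> z)"
    \<comment> \<open>Functions in \<open>PiE\<close> are undefined outside the index set,
      multi-indices are 0 there; the witnesses translate between the two conventions.\<close>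
    by (rule sum.reindex_bij_witness[where i = "\<lambda>\<beta>. restrict \<beta> {..<n}" and j = "\<lambda>f j. if j < n then f j else 0"])
      (auto simp: M_def multi_idx_def PiE_def extensional_def restrict_def fun_eq_iff c_def monomial_def
        prod.distrib Pi_def)
  also have "\<dots> = c \<alpha> * monomial n \<alpha> z + (\<Sum>\<beta>\<in>M - {\<alpha>}. c \<beta> * monomial n \<beta> z)"
    using finM \<alpha>M by (rule sum.remove)
  also have "(\<Sum>\<beta>\<in>M - {\<alpha>}. c \<beta> * monomial n \<beta> z) = (\<Sum>\<beta>\<in>{\<beta>. before n \<beta> \<alpha>}. c \<beta> * monomial n \<beta> z)"
  proof (rule sum.mono_neutral_left[OF finite_before])
    show "M - {\<alpha>} \<subseteq> {\<beta>. before n \<beta> \<alpha>}"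
    proof
      fix \<beta> assume "\<beta> \<in> M - {\<alpha>}"
      then have \<beta>: "\<beta> \<in> multi_idx n" "\<And>j. j < n \<Longrightarrow> \<beta> j \<le> \<alpha> j" "\<beta> \<noteq> \<alpha>" by (auto simp: M_def)
      then obtain j where "\<beta> j \<noteq> \<alpha> j" by blast
      then have "j < n" "\<beta> j < \<alpha> j" using \<alpha> \<beta> unfolding multi_idx_def
        by (metis (mono_tags, lifting) linorder_not_le mem_Collect_eq,
            metis (mono_tags, lifting) linorder_not_le mem_Collect_eq order_le_less)
      then have "mdeg n \<beta> < mdeg n \<alpha>" unfolding mdeg_def using \<beta> by (intro sum_strict_mono_ex1) auto
      then show "\<beta> \<in> {\<beta>. before n \<beta> \<alpha>}" using \<beta> by (simp add: before_def)
    qed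
    show "\<forall>\<beta>\<in>{\<beta>. before n \<beta> \<alpha>} - (M - {\<alpha>}). c \<beta> * monomial n \<beta> z = 0"
    proof
      fix \<beta> assume "\<beta> \<in> {\<beta>. before n \<beta> \<alpha>} - (M - {\<alpha>})"
      then have "before n \<beta> \<alpha>" "\<beta> \<notin> M" using not_before_self by auto
      then obtain j where "j < n" "\<alpha> j < \<beta> j" using beforeD(1) by (auto simp: M_def not_le)
      then have "c \<beta> = 0" unfolding c_def using p by (intro prod_zero) (auto intro!: bexI[of _ j] coeff_eq_0)
      then show "c \<beta> * monomial n \<beta> z = 0" by simp
    qed
  qed
  finally show ?thesis by (simp add: c\<alpha> P_poly_def c_def[symmetric])
qed

text \<open>The upper bound is the product of one-variable extremal polynomials.\<close>

lemma cheb_t_eq_prod: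
  assumes \<alpha>: "\<alpha> \<in> multi_idx n"
  shows "cheb_t n Ks \<alpha> = (\<Prod>j<n. cheb1 (Ks j) (\<alpha> j))"
proof (rule antisym)
  show "(\<Prod>j<n. cheb1 (Ks j) (\<alpha> j)) \<le> cheb_t n Ks \<alpha>"
    unfolding cheb_t_def by (intro cINF_greatest prod_cheb1_le_sup_norm) auto
  have "\<exists>p. degree p = \<alpha> j \<and> lead_coeff p = 1 \<and> (\<forall>x\<in>Ks j. cmod (poly p (of_real x)) \<le> cheb1 (Ks j) (\<alpha> j))"
    if "j < n" for j
    using that by (intro cheb1_attained non_polar_infinite K np)
  then obtain p where p: "\<And>j. j < n \<Longrightarrow> degree (p j) = \<alpha> j" "\<And>j. j < n \<Longrightarrow> lead_coeff (p j) = 1"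
    and pb: "\<And>j x. j < n \<Longrightarrow> x \<in> Ks j \<Longrightarrow> cmod (poly (p j) (of_real x)) \<le> cheb1 (Ks j) (\<alpha> j)"
    by metis
  define c where "c \<beta> = (\<Prod>j<n. coeff (p j) (\<beta> j))" for \<beta>
  have "bdd_below (range (\<lambda>c. sup_norm (prod_set n Ks) (P_poly n \<alpha> c)))"
    using prod_cheb1_le_sup_norm by (intro bdd_belowI2) auto
  then have "cheb_t n Ks \<alpha> \<le> sup_norm (prod_set n Ks) (P_poly n \<alpha> c)"
    unfolding cheb_t_def by (intro cINF_lower) auto
  also have "\<dots> \<le> (\<Prod>j<n. cheb1 (Ks j) (\<alpha> j))"
    unfolding sup_norm_def
  proof (rule cSUP_least[OF prod_set_nonempty])
    fix z assume z: "z \<in> prod_set n Ks"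
    have "cmod (P_poly n \<alpha> c z) = (\<Prod>j<n. cmod (poly (p j) (z j)))"
      unfolding c_def using P_poly_of_product[OF \<alpha> p, of z] by (simp add: prod_norm)
    also have "\<dots> \<le> (\<Prod>j<n. cheb1 (Ks j) (\<alpha> j))"
      using z pb by (intro prod_mono) (auto simp: prod_set_def)
    finally show "cmod (P_poly n \<alpha> c z) \<le> (\<Prod>j<n. cheb1 (Ks j) (\<alpha> j))" .
  qed
  finally show "cheb_t n Ks \<alpha> \<le> (\<Prod>j<n. cheb1 (Ks j) (\<alpha> j))" .
qed

end

section \<open>The enumeration of multi-indices and the lower limit\<close>

lemma lex_prec_trans:
  assumes "lex_prec n \<alpha> \<beta>" "lex_prec n \<beta> \<gamma>"
  shows "lex_prec n \<alpha> \<gamma>"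
proof -
  obtain l where l: "l < n" "\<beta> l < \<alpha> l" "\<And>k. k < l \<Longrightarrow> \<beta> k = \<alpha> k"
    using assms(1) by (auto simp: lex_prec_def)
  obtain m where m: "m < n" "\<gamma> m < \<beta> m" "\<And>k. k < m \<Longrightarrow> \<gamma> k = \<beta> k"
    using assms(2) by (auto simp: lex_prec_def)
  show ?thesis unfolding lex_prec_def
  proof (intro exI[of _ "min l m"] conjI allI impI)
    show "\<gamma> (min l m) < \<alpha> (min l m)"
      using l m by (cases l m rule: linorder_cases) auto
  qed (use l m in auto)
qed

lemma lex_prec_total:
  assumes "\<alpha> \<in> multi_idx n" "\<beta> \<in> multi_idx n" "\<alpha> \<noteq> \<beta>"
  shows "lex_prec n \<alpha> \<beta> \<or> lex_prec n \<beta> \<alpha>"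
proof -
  define l where "l = (LEAST j. \<alpha> j \<noteq> \<beta> j)"
  have "\<exists>j. \<alpha> j \<noteq> \<beta> j" using assms(3) by auto
  then have l: "\<alpha> l \<noteq> \<beta> l" unfolding l_def by (rule LeastI_ex)
  have eq: "\<alpha> k = \<beta> k" if "k < l" for k using that not_less_Least unfolding l_def by blast
  have "l < n" using l assms by (auto simp: multi_idx_def not_le[symmetric])
  then show ?thesis using l eq unfolding lex_prec_def by (metis linorder_neqE_nat)
qed

lemma before_trans: "before n \<alpha> \<beta> \<Longrightarrow> before n \<beta> \<gamma> \<Longrightarrow> before n \<alpha> \<gamma>"
  using lex_prec_trans[of n \<alpha> \<beta> \<gamma>] by (auto simp: before_def)

lemma before_total:
  "\<alpha> \<in> multi_idx n \<Longrightarrow> \<beta> \<in> multi_idx n \<Longrightarrow> \<alpha> \<noteq> \<beta> \<Longrightarrow> before n \<alpha> \<beta> \<or> before n \<beta> \<alpha>"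
  using lex_prec_total[of \<alpha> n \<beta>] by (auto simp: before_def)

definition mi_rank :: "nat \<Rightarrow> (nat \<Rightarrow> nat) \<Rightarrow> nat" where
  "mi_rank n \<alpha> = card {\<beta>. before n \<beta> \<alpha>}"

lemma mi_rank_less: "before n \<alpha> \<beta> \<Longrightarrow> mi_rank n \<alpha> < mi_rank n \<beta>"
  unfolding mi_rank_def
  by (rule psubset_card_mono[OF finite_before]) (use before_trans not_before_self in blast)

lemma inj_on_mi_rank: "inj_on (mi_rank n) (multi_idx n)"
proof (rule inj_onI, rule ccontr)
  fix \<alpha> \<beta> assume "\<alpha> \<in> multi_idx n" "\<beta> \<in> multi_idx n" "mi_rank n \<alpha> = mi_rank n \<beta>" "\<alpha> \<noteq> \<beta>"
  then show False using before_total[of \<alpha> n \<beta>] mi_rank_less[of n \<alpha> \<beta>] mi_rank_less[of n \<beta> \<alpha>] by auto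
qed

text \<open>The predecessors of \<alpha> have distinct ranks below that of \<alpha>, and there are
  exactly as many of them as such numbers.\<close>

lemma mi_rank_initial_segment:
  assumes "\<alpha> \<in> multi_idx n" "i < mi_rank n \<alpha>"
  shows "\<exists>\<beta>\<in>multi_idx n. mi_rank n \<beta> = i"
proof -
  define S where "S = {\<beta>. before n \<beta> \<alpha>}"
  have S: "S \<subseteq> multi_idx n" using beforeD(1) by (auto simp: S_def)
  have "mi_rank n ` S = {..<mi_rank n \<alpha>}"
  proof (rule card_subset_eq)
    show "mi_rank n ` S \<subseteq> {..<mi_rank n \<alpha>}" using mi_rank_less by (auto simp: S_def)
    show "card (mi_rank n ` S) = card {..<mi_rank n \<alpha>}"
      using card_image[OF inj_on_subset[OF inj_on_mi_rank S]] by (simp add: S_def mi_rank_def)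
  qed simp
  then show ?thesis using assms(2) S by (metis imageE lessThan_iff subsetD)
qed

text \<open>The exponent of the pure power of one coordinate, through which one-variable Chebyshev
  numbers occur among those of the product set.\<close>

definition axis_idx :: "nat \<Rightarrow> nat \<Rightarrow> nat \<Rightarrow> nat" where
  "axis_idx j k = (\<lambda>i. if i = j then k else 0)"

lemma axis_idx:
  assumes "j < n"
  shows "axis_idx j k \<in> multi_idx n" "mdeg n (axis_idx j k) = k"
  using assms by (auto simp: axis_idx_def multi_idx_def mdeg_def)

text \<open>Makes ranks unbounded, so every number is a rank, and places the pure powers of high
  degree late in the enumeration.\<close>

lemma mi_rank_axis_idx_ge: "j < n \<Longrightarrow> k \<le> mi_rank n (axis_idx j k)"
proof (induction k)
  case (Suc k)
  have "before n (axis_idx j k) (axis_idx j (Suc k))" using axis_idx[OF Suc.prems] by (simp add: before_def)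
  with Suc mi_rank_less[OF this] show ?case by simp
qed simp

text \<open>The description by \<open>THE\<close> is proper: existence comes from initial segments
  of ranks, uniqueness from injectivity of the rank.\<close>

lemma enum_mi:
  assumes "n \<ge> 1"
  shows "enum_mi n i \<in> multi_idx n" "mi_rank n (enum_mi n i) = i"
proof -
  have "i < mi_rank n (axis_idx 0 (Suc i))" using mi_rank_axis_idx_ge[of 0 n "Suc i"] assms by simp
  then obtain \<beta> where \<beta>: "\<beta> \<in> multi_idx n" "mi_rank n \<beta> = i"
    using mi_rank_initial_segment axis_idx(1)[of 0 n] assms by (metis less_le_trans zero_less_one)
  have "\<exists>!\<alpha>. \<alpha> \<in> multi_idx n \<and> card {\<beta>. before n \<beta> \<alpha>} = i"
    unfolding mi_rank_def[symmetric] using \<beta> inj_on_mi_rank[of n] by (auto dest: inj_onD)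
  from theI'[OF this, folded enum_mi_def] show "enum_mi n i \<in> multi_idx n" "mi_rank n (enum_mi n i) = i"
    by (simp_all add: mi_rank_def)
qed

lemma enum_mi_rank:
  assumes "n \<ge> 1" "\<alpha> \<in> multi_idx n"
  shows "enum_mi n (mi_rank n \<alpha>) = \<alpha>"
  using enum_mi[OF assms(1)] inj_on_mi_rank[of n] assms(2) by (meson inj_onD)

lemma mdeg_enum_mi_pos:
  assumes "n \<ge> 1" "i \<ge> 1"
  shows "mdeg n (enum_mi n i) \<ge> 1"
proof (rule ccontr)
  assume "\<not> ?thesis"
  then have "enum_mi n i j = 0" if "j < n" for j using le_mdeg[OF that, of "enum_mi n i"] by simp
  then have "{\<beta>. before n \<beta> (enum_mi n i)} = {}" using beforeD(3) by fastforce
  then have "mi_rank n (enum_mi n i) = 0" by (simp add: mi_rank_def)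
  then show False using enum_mi(2)[OF assms(1), of i] assms(2) by simp
qed

section \<open>Bounds for the product set and the value of the lower limit\<close>

context non_polar_product
begin

lemma cap_pos: "j < n \<Longrightarrow> log_cap (Ks j) > 0"
  using np by (simp add: non_polar_def)

lemma cheb1_ge_factor:
  "j < n \<Longrightarrow> 2 ^ (if k = 0 then 0 else 1) * log_cap (Ks j) ^ k \<le> cheb1 (Ks j) k"
  using cheb1_ge_log_cap[OF K np, of j k] cheb1_0[OF K, of j] non_polar_nonempty[OF np, of j] by auto

lemma cheb_t_ge:
  assumes "\<alpha> \<in> multi_idx n"
  shows "(\<Prod>j<n. (2::real) ^ (if \<alpha> j = 0 then 0 else 1)) * (\<Prod>j<n. log_cap (Ks j) ^ \<alpha> j) \<le> cheb_t n Ks \<alpha>"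
  unfolding cheb_t_eq_prod[OF assms] prod.distrib[symmetric]
  using cheb1_ge_factor cap_pos by (intro prod_mono) (auto intro!: mult_nonneg_nonneg less_imp_le)

text \<open>A product of factorwise inequalities between positive numbers is an equality only if
  every factor is; factors with exponent 0 are 1 on both sides.\<close>

lemma cheb_t_eq_iff:
  assumes "\<alpha> \<in> multi_idx n"
  shows "cheb_t n Ks \<alpha> =
      (\<Prod>j<n. (2::real) ^ (if \<alpha> j = 0 then 0 else 1)) * (\<Prod>j<n. log_cap (Ks j) ^ \<alpha> j)
    \<longleftrightarrow> (\<forall>j<n. \<alpha> j = 0 \<or> cheb1 (Ks j) (\<alpha> j) = 2 * log_cap (Ks j) ^ \<alpha> j)"
    (is "?L \<longleftrightarrow> ?R")
proof -
  define f where "f j = (2::real) ^ (if \<alpha> j = 0 then 0 else 1) * log_cap (Ks j) ^ \<alpha> j" for j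
  have f: "0 < f j" "f j \<le> cheb1 (Ks j) (\<alpha> j)" if "j < n" for j
    using cheb1_ge_factor[OF that] cap_pos[OF that] by (auto simp: f_def)
  have "?L \<longleftrightarrow> (\<Prod>j<n. cheb1 (Ks j) (\<alpha> j)) = (\<Prod>j<n. f j)"
    by (simp add: cheb_t_eq_prod[OF assms] f_def prod.distrib)
  also have "\<dots> \<longleftrightarrow> (\<forall>j<n. cheb1 (Ks j) (\<alpha> j) = f j)"
  proof
    assume eq: "(\<Prod>j<n. cheb1 (Ks j) (\<alpha> j)) = (\<Prod>j<n. f j)"
    show "\<forall>j<n. cheb1 (Ks j) (\<alpha> j) = f j"
    proof (intro allI impI, rule ccontr)
      fix j assume j: "j < n" "cheb1 (Ks j) (\<alpha> j) \<noteq> f j"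
      then have "f j < cheb1 (Ks j) (\<alpha> j)" using f(2)[of j] by simp
      then have "(\<Prod>j<n. f j) < (\<Prod>j<n. cheb1 (Ks j) (\<alpha> j))"
        using f j by (intro prod_mono_strict[of j]) (auto intro: less_imp_le less_le_trans)
      with eq show False by simp
    qed
  qed simp
  also have "\<dots> \<longleftrightarrow> ?R"
    using cheb1_0 K np non_polar_nonempty by (auto simp: f_def split: if_splits)
  finally show ?thesis .
qed

text \<open>The upper bound for the lower limit comes from the indices \<^term>\<open>axis_idx j k\<close> alone.\<close>

lemma tau_minus_eq: "tau_minus n Ks = (MIN j\<in>{..<n}. log_cap (Ks j))"
proof -
  define c where "c = (MIN j\<in>{..<n}. log_cap (Ks j))"
  have ne: "{..<n} \<noteq> {}" using n by (auto simp: lessThan_empty_iff)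
  have cle: "c \<le> log_cap (Ks j)" if "j < n" for j unfolding c_def using that by (intro Min_le) auto
  have "c \<in> (\<lambda>j. log_cap (Ks j)) ` {..<n}" unfolding c_def using ne by (intro Min_in) auto
  then obtain j0 where j0: "j0 < n" "c = log_cap (Ks j0)" by blast
  have cpos: "c > 0" using cap_pos j0 by simp
  define h where "h i = cheb_t n Ks (enum_mi n i) powr (1 / real (mdeg n (enum_mi n i)))" for i
  \<comment> \<open>Index 0 is left out because its degree is 0 and the exponent
    \<open>1 / 0\<close> is 0 by convention.\<close>
  have "c \<le> h i" if "i \<ge> 1" for i
  proof -
    define \<alpha> where "\<alpha> = enum_mi n i"
    define d where "d = mdeg n \<alpha>"
    have d: "d \<ge> 1" unfolding d_def \<alpha>_def using mdeg_enum_mi_pos[OF n that] .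
    have "c ^ d = (\<Prod>j<n. c ^ \<alpha> j)" by (simp add: d_def mdeg_def power_sum)
    also have "\<dots> \<le> (\<Prod>j<n. cheb1 (Ks j) (\<alpha> j))"
    proof (rule prod_mono)
      fix j assume "j \<in> {..<n}"
      then have j: "j < n" by simp
      have "c ^ \<alpha> j \<le> log_cap (Ks j) ^ \<alpha> j" using cle[OF j] cpos by (intro power_mono) auto
      also have "\<dots> \<le> 2 ^ (if \<alpha> j = 0 then 0 else 1) * log_cap (Ks j) ^ \<alpha> j"
        using cap_pos[OF j] by simp
      also have "\<dots> \<le> cheb1 (Ks j) (\<alpha> j)" by (rule cheb1_ge_factor[OF j])
      finally show "0 \<le> c ^ \<alpha> j \<and> c ^ \<alpha> j \<le> cheb1 (Ks j) (\<alpha> j)" using cpos by simp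
    qed
    also have "\<dots> = cheb_t n Ks \<alpha>" using cheb_t_eq_prod[OF enum_mi(1)[OF n]] by (simp add: \<alpha>_def)
    finally have "(c ^ d) powr (1 / real d) \<le> cheb_t n Ks \<alpha> powr (1 / real d)"
      using cpos by (intro powr_mono2) auto
    moreover have "(c ^ d) powr (1 / real d) = c"
      using cpos d by (simp add: powr_realpow[symmetric] powr_powr)
    ultimately show ?thesis by (simp add: h_def \<alpha>_def d_def)
  qed
  then have lower: "ereal c \<le> liminf (\<lambda>i. ereal (h i))"
    by (intro Liminf_bounded eventually_sequentiallyI[of 1]) auto
  have "\<not> ereal c < liminf (\<lambda>i. ereal (h i))"
  proof
    assume "ereal c < liminf (\<lambda>i. ereal (h i))"
    then obtain s where s: "ereal c < ereal s" "ereal s < liminf (\<lambda>i. ereal (h i))"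
      using ereal_dense2 by blast
    then have spos: "s > 0" "c < s" using cpos by auto
    have "eventually (\<lambda>i. ereal s < ereal (h i)) sequentially" by (rule less_LiminfD[OF s(2)])
    then obtain k0 where k0: "\<And>i. i \<ge> k0 \<Longrightarrow> s < h i" by (auto simp: eventually_sequentially)
    \<comment> \<open>The rank of the pure power is at least \<open>k\<close>, so the eventual
      inequality already holds there.\<close>
    have big: "s ^ k \<le> cheb1 (Ks j0) k" if k: "k \<ge> max 1 k0" for k
    proof -
      define \<alpha> where "\<alpha> = axis_idx j0 k"
      have \<alpha>: "\<alpha> \<in> multi_idx n" "mdeg n \<alpha> = k" "k \<le> mi_rank n \<alpha>"
        unfolding \<alpha>_def by (rule axis_idx[OF j0(1)] mi_rank_axis_idx_ge[OF j0(1)])+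
      have "cheb_t n Ks \<alpha> = (\<Prod>j<n. if j = j0 then cheb1 (Ks j0) k else 1)"
        unfolding cheb_t_eq_prod[OF \<alpha>(1)]
        using cheb1_0 K np non_polar_nonempty by (intro prod.cong) (auto simp: \<alpha>_def axis_idx_def)
      also have "\<dots> = cheb1 (Ks j0) k" using j0(1) by simp
      finally have t: "cheb_t n Ks \<alpha> = cheb1 (Ks j0) k" .
      have pos: "cheb1 (Ks j0) k > 0" by (rule cheb1_pos[OF j0(1)])
      have "s < h (mi_rank n \<alpha>)" using k \<alpha>(3) by (intro k0) auto
      then have "s < cheb1 (Ks j0) k powr (1 / real k)"
        by (simp add: h_def enum_mi_rank[OF n \<alpha>(1)] \<alpha>(2) t)
      then have "s ^ k \<le> (cheb1 (Ks j0) k powr (1 / real k)) ^ k"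
        using spos by (intro power_mono) auto
      also have "\<dots> = cheb1 (Ks j0) k" using k pos by (simp add: powr_powr flip: powr_realpow)
      finally show ?thesis .
    qed
    \<comment> \<open>A constant small enough to cover the finitely many degrees below
      \<open>max 1 k0\<close>; as it is at most 1, the large degrees keep their bound.\<close>
    define e where "e = Min (insert 1 ((\<lambda>k. cheb1 (Ks j0) k / s ^ k) ` {..<max 1 k0}))"
    have e: "e > 0" "e \<le> 1" and e_le: "k < max 1 k0 \<Longrightarrow> e \<le> cheb1 (Ks j0) k / s ^ k" for k
      unfolding e_def using cheb1_pos[OF j0(1)] spos by (auto simp: Min_gr_iff)
    have "s \<le> log_cap (Ks j0)"
    proof (rule log_cap_ge[OF K[OF j0(1)] np[OF j0(1)] e(1) spos(1)])
      fix k
      show "e * s ^ k \<le> cheb1 (Ks j0) k"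
      proof (cases "k < max 1 k0")
        case True
        from e_le[OF this] spos show ?thesis by (simp add: pos_le_divide_eq)
      next
        case False
        have "e * s ^ k \<le> 1 * s ^ k" using e spos by (intro mult_right_mono) auto
        with big[of k] False show ?thesis by linarith
      qed
    qed
    with spos j0 show False by simp
  qed
  with lower have "liminf (\<lambda>i. ereal (h i)) = ereal c" by simp
  then show ?thesis by (simp add: tau_minus_def h_def c_def)
qed

text \<open>A positive degree has a positive exponent, which supplies one factor 2; replacing each
  capacity by the smallest one, the lower limit, only decreases the product.\<close>

lemma W_inf_ge_2:
  assumes "i \<ge> 1"
  shows "2 \<le> W_inf n Ks i"
proof -
  define c where "c = (MIN j\<in>{..<n}. log_cap (Ks j))"
  have ne: "{..<n} \<noteq> {}" using n by (auto simp: lessThan_empty_iff)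
  have c: "c > 0" "\<And>j. j < n \<Longrightarrow> c \<le> log_cap (Ks j)"
    unfolding c_def using ne cap_pos by (auto simp: Min_gr_iff)
  define \<alpha> where "\<alpha> = enum_mi n i"
  have \<alpha>: "\<alpha> \<in> multi_idx n" "mdeg n \<alpha> \<ge> 1"
    using enum_mi[OF n] mdeg_enum_mi_pos[OF n assms] by (auto simp: \<alpha>_def)
  obtain j where j: "j < n" "\<alpha> j \<noteq> 0"
    using \<alpha>(2) unfolding mdeg_def by (metis lessThan_iff not_one_le_zero sum.neutral)
  have "(\<Prod>j<n. (2::real) ^ (if \<alpha> j = 0 then 0 else 1)) =
      2 * (\<Prod>j\<in>{..<n} - {j}. 2 ^ (if \<alpha> j = 0 then 0 else 1))"
    using j by (simp add: prod.remove[of _ j])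
  moreover have "1 \<le> (\<Prod>j\<in>{..<n} - {j}. (2::real) ^ (if \<alpha> j = 0 then 0 else 1))"
    by (intro prod_ge_1) auto
  ultimately have two: "2 \<le> (\<Prod>j<n. (2::real) ^ (if \<alpha> j = 0 then 0 else 1))" by linarith
  have "c ^ mdeg n \<alpha> = (\<Prod>j<n. c ^ \<alpha> j)" by (simp add: mdeg_def power_sum)
  also have "\<dots> \<le> (\<Prod>j<n. log_cap (Ks j) ^ \<alpha> j)"
    using c by (intro prod_mono) (auto intro!: power_mono)
  finally have "2 * c ^ mdeg n \<alpha> \<le>
      (\<Prod>j<n. (2::real) ^ (if \<alpha> j = 0 then 0 else 1)) * (\<Prod>j<n. log_cap (Ks j) ^ \<alpha> j)"
    using two c by (intro mult_mono) auto
  also have "\<dots> \<le> cheb_t n Ks \<alpha>" by (rule cheb_t_ge[OF \<alpha>(1)])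
  finally show ?thesis
    using c by (simp add: W_inf_def tau_minus_eq c_def[symmetric] \<alpha>_def[symmetric] pos_le_divide_eq)
qed

end

theorem theorem4p6:
  fixes n :: nat and Ks :: "nat \<Rightarrow> real set" and \<alpha> :: "nat \<Rightarrow> nat"
  assumes "n \<ge> 1"
    and "\<And>j. j < n \<Longrightarrow> compact (Ks j)"
    and "\<And>j. j < n \<Longrightarrow> non_polar (Ks j)"
    and "\<alpha> \<in> multi_idx n"
  shows "cheb_t n Ks \<alpha> \<ge>
           (\<Prod>j<n. (2::real) ^ (if \<alpha> j = 0 then 0 else 1)) * (\<Prod>j<n. log_cap (Ks j) ^ \<alpha> j)
       \<and> (\<forall>i\<ge>1. W_inf n Ks i \<ge> 2)
       \<and> (cheb_t n Ks \<alpha> =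
           (\<Prod>j<n. (2::real) ^ (if \<alpha> j = 0 then 0 else 1)) * (\<Prod>j<n. log_cap (Ks j) ^ \<alpha> j)
         \<longleftrightarrow> (\<forall>j<n. \<alpha> j = 0 \<or>
               (\<exists>R :: complex poly. degree R = \<alpha> j \<and>
                  complex_of_real ` Ks j = {z. poly R z \<in> complex_of_real ` {-1..1}})))"
proof -
  interpret non_polar_product n Ks by unfold_locales (use assms in auto)
  have "cheb1 (Ks j) (\<alpha> j) = 2 * log_cap (Ks j) ^ \<alpha> j \<longleftrightarrow>
      (\<exists>R :: complex poly. degree R = \<alpha> j \<and>
         complex_of_real ` Ks j = {z. poly R z \<in> complex_of_real ` {-1..1}})"
    if "j < n" "\<alpha> j \<noteq> 0" for j
    using cheb1_eq_imp_preimage[OF K np, of j "\<alpha> j"]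
      preimage_imp_cheb1_eq[OF K np, of j _ "\<alpha> j"] that by (auto simp: Suc_le_eq)
  then show ?thesis
    using cheb_t_ge[OF assms(4)] W_inf_ge_2 cheb_t_eq_iff[OF assms(4)] by blast
qed

end
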